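(* Let $0\le k\le\mu$ be integers. For every $f\in C(\mathbb{CP}^1)$ and every positive integer $n$, $$\lim_{\nu\to\infty}\frac1\nu\,\mathrm{Tr}\Big(\mathcal{T}^\nu_{\mu,k}\big(R_\mu^*(f)\big)^n\Big)=\int_{\mathbb{C}}E_{\mu,k}(f)^n\,d\iota(z).$$
   Context: For an integer $\tau\ge0$, $\mathcal{H}_\tau$ is the space of polynomials in one complex variable of degree $\le\tau$, with inner product $\langle f,g\rangle=\int_{\mathbb{C}}f\overline g\,d\iota_\tau$, $d\iota_\tau(z)=\frac{\tau+1}{(1+|z|^2)^\tau}\frac{dA(z)}{\pi(1+|z|^2)^2}$ ($dA$ Lebesgue measure); $d\iota:=d\iota_0$. $C(\mathbb{CP}^1)$: continuous functions on $\mathbb{C}$ extending continuously to $\infty$. $R_\mu^*(f)$ is the operator on $\mathcal{H}_\mu$ with $(R_\mu^*(f)h)(x)=\frac1{\mu+1}\int_{\mathbb{C}}f(z)h(z)(1+x\overline z)^\mu d\iota_\mu(z)$. $B_\tau(f)(z)=\int_{\mathbb{C}}\frac{|1+z\overline s|^{2\tau}}{(1+|z|^2)^\tau(1+|s|^2)^\tau}f(s)\,d\iota(s)$ is the Berezin transform and $E_{\mu,k}(f):=\binom{\mu}{k}\sum_{l=0}^k(-1)^{k-l}\binom kl B_{\mu-l}(f)$. For $\nu>\mu$: $\mathcal{H}_\mu\otimes\mathcal{H}_\nu$ is realized as polynomials $F(z,w)$ of degree $\le\mu$ in $z$, $\le\nu$ in $w$, with inner product of $L^2(d\iota_\mu(z)d\iota_\nu(w))$;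 $J_k(F)(\xi)=\int_{\mathbb{C}^2}F(z,w)(\overline z-\overline w)^k(1+\xi\overline z)^{\mu-k}(1+\xi\overline w)^{\nu-k}d\iota_\mu(z)d\iota_\nu(w)\in\mathcal{H}_{\mu+\nu-2k}$; $C_{\mu,\nu,k}>0$ with $C_{\mu,\nu,k}^2=\frac{(-\nu)_k(-\mu)_k}{k!(\mu+\nu-2k+2)_k}$ (rising Pochhammer $(a)_n=a(a+1)\cdots(a+n-1)$); $P_k=C_{\mu,\nu,k}J_k$; and $\mathcal{T}^\nu_{\mu,k}(A)=P_k(A\otimes I)P_k^*\in B(\mathcal{H}_{\mu+\nu-2k})$ for $A\in B(\mathcal{H}_\mu)$, $I$ the identity of $\mathcal{H}_\nu$. *)

theory Defs
  imports "HOL-Analysis.Analysis"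
begin

definition iota_dens :: "nat \<Rightarrow> complex \<Rightarrow> real" where
  "iota_dens \<tau> z = (real \<tau> + 1) / (1 + (cmod z)^2) ^ \<tau> / (pi * (1 + (cmod z)^2)^2)"

definition iota :: "nat \<Rightarrow> complex measure" where
  "iota \<tau> = density lborel (\<lambda>z. ennreal (iota_dens \<tau> z))"

definition H :: "nat \<Rightarrow> (complex \<Rightarrow> complex) set" where
  "H \<tau> = {g. \<exists>p::complex poly. degree p \<le> \<tau> \<and> g = poly p}"

definition inner_H :: "nat \<Rightarrow> (complex \<Rightarrow> complex) \<Rightarrow> (complex \<Rightarrow> complex) \<Rightarrow> complex" where
  "inner_H \<tau> f g = (LINT z|iota \<tau>. f z * cnj (g z))"

definition onb :: "nat \<Rightarrow> nat \<Rightarrow> complex \<Rightarrow> complex" where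
  "onb \<tau> j = (\<lambda>z. complex_of_real (sqrt (real (\<tau> choose j))) * z ^ j)"

definition trace_H :: "nat \<Rightarrow> ((complex \<Rightarrow> complex) \<Rightarrow> (complex \<Rightarrow> complex)) \<Rightarrow> complex" where
  "trace_H \<tau> A = (\<Sum>j\<le>\<tau>. inner_H \<tau> (A (onb \<tau> j)) (onb \<tau> j))"

definition cont_CP1 :: "(complex \<Rightarrow> complex) \<Rightarrow> bool" where
  "cont_CP1 f \<longleftrightarrow> continuous_on UNIV f \<and> (\<exists>L. (f \<longlongrightarrow> L) at_infinity)"

definition Rstar :: "nat \<Rightarrow> (complex \<Rightarrow> complex) \<Rightarrow> (complex \<Rightarrow> complex) \<Rightarrow> (complex \<Rightarrow> complex)" where
  "Rstar \<mu> f h = (\<lambda>x. (1 / (of_nat \<mu> + 1)) *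
      (LINT z|iota \<mu>. f z * h z * (1 + x * cnj z) ^ \<mu>))"

definition Berezin :: "nat \<Rightarrow> (complex \<Rightarrow> complex) \<Rightarrow> complex \<Rightarrow> complex" where
  "Berezin \<tau> f z = (LINT s|iota 0.
      complex_of_real ((cmod (1 + z * cnj s)) ^ (2 * \<tau>) /
        ((1 + (cmod z)^2) ^ \<tau> * (1 + (cmod s)^2) ^ \<tau>)) * f s)"

definition E :: "nat \<Rightarrow> nat \<Rightarrow> (complex \<Rightarrow> complex) \<Rightarrow> complex \<Rightarrow> complex" where
  "E \<mu> k f z = of_nat (\<mu> choose k) *
      (\<Sum>l\<le>k. (-1) ^ (k - l) * of_nat (k choose l) * Berezin (\<mu> - l) f z)"

text \<open>Elements of H_mu (x) H_nu are realised as functions F z w.\<close>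
definition Jk :: "nat \<Rightarrow> nat \<Rightarrow> nat \<Rightarrow> (complex \<Rightarrow> complex \<Rightarrow> complex) \<Rightarrow> complex \<Rightarrow> complex" where
  "Jk \<mu> \<nu> k F = (\<lambda>\<xi>. LINT p|(iota \<mu> \<Otimes>\<^sub>M iota \<nu>).
      F (fst p) (snd p) * (cnj (fst p) - cnj (snd p)) ^ k *
      (1 + \<xi> * cnj (fst p)) ^ (\<mu> - k) * (1 + \<xi> * cnj (snd p)) ^ (\<nu> - k))"

definition Cmnk :: "nat \<Rightarrow> nat \<Rightarrow> nat \<Rightarrow> real" where
  "Cmnk \<mu> \<nu> k = sqrt (pochhammer (- real \<nu>) k * pochhammer (- real \<mu>) k /
      (fact k * pochhammer (real \<mu> + real \<nu> - 2 * real k + 2) k))"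

definition Pk :: "nat \<Rightarrow> nat \<Rightarrow> nat \<Rightarrow> (complex \<Rightarrow> complex \<Rightarrow> complex) \<Rightarrow> complex \<Rightarrow> complex" where
  "Pk \<mu> \<nu> k F = (\<lambda>\<xi>. complex_of_real (Cmnk \<mu> \<nu> k) * Jk \<mu> \<nu> k F \<xi>)"

text \<open>Adjoint of P_k, written in the orthonormal basis e_a (x) e_b of H_mu (x) H_nu.\<close>
definition Pk_adj :: "nat \<Rightarrow> nat \<Rightarrow> nat \<Rightarrow> (complex \<Rightarrow> complex) \<Rightarrow> complex \<Rightarrow> complex \<Rightarrow> complex" where
  "Pk_adj \<mu> \<nu> k g = (\<lambda>z w. \<Sum>a\<le>\<mu>. \<Sum>b\<le>\<nu>.
      inner_H (\<mu> + \<nu> - 2 * k) g (Pk \<mu> \<nu> k (\<lambda>z' w'. onb \<mu> a z' * onb \<nu> b w'))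
        * onb \<mu> a z * onb \<nu> b w)"

text \<open>A (x) I: apply A in the first variable (A linear).\<close>
definition tensor_id :: "((complex \<Rightarrow> complex) \<Rightarrow> (complex \<Rightarrow> complex)) \<Rightarrow>
    (complex \<Rightarrow> complex \<Rightarrow> complex) \<Rightarrow> complex \<Rightarrow> complex \<Rightarrow> complex" where
  "tensor_id A F = (\<lambda>z w. A (\<lambda>z'. F z' w) z)"

definition Tmap :: "nat \<Rightarrow> nat \<Rightarrow> nat \<Rightarrow> ((complex \<Rightarrow> complex) \<Rightarrow> (complex \<Rightarrow> complex)) \<Rightarrow>
    (complex \<Rightarrow> complex) \<Rightarrow> (complex \<Rightarrow> complex)" where
  "Tmap \<mu> \<nu> k A = (\<lambda>g. Pk \<mu> \<nu> k (tensor_id A (Pk_adj \<mu> \<nu> k g)))"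

end

theory Submission
  imports Defs "HOL-Real_Asymp.Real_Asymp"
begin

text \<open>
  In the bases \<open>onb\<close>, the map \<open>Pk\<close> sends \<open>e\<^sub>a \<otimes> e\<^sub>b\<close> to a multiple of \<open>e\<^sub>a\<^sub>+\<^sub>b\<^sub>-\<^sub>k\<close>, the multiple
  being a Clebsch-Gordan coefficient. Hence \<open>Tmap \<mu> \<nu> k A\<close> has a matrix of bandwidth \<open>\<mu>\<close> built from the
  fixed matrix of \<open>A\<close> and these coefficients. Along indices \<open>b\<close> with \<open>b / \<nu> \<longlonglongrightarrow> x\<close> the coefficients
  converge, being sums of square roots of quotients of binomial coefficients with bounded shifts; so the
  matrices are locally Toeplitz, with a Laurent polynomial in \<open>u\<close> depending on \<open>x\<close> as their symbol.
  Symbols multiply under products of matrices, and the normalised trace of a locally Toeplitz sequence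
  tends to the integral over \<open>x \<in> [0,1]\<close> of the constant coefficient of the symbol. In the coordinates
  \<open>x = |z|\<^sup>2 / (1 + |z|\<^sup>2)\<close> and \<open>u = sgn z\<close> the measure \<open>\<iota>\<close> is the uniform one, and the symbol for
  \<open>A = Rstar \<mu> f\<close> is \<open>E \<mu> k f\<close>: both are the expectation of \<open>A\<close> in the normalised vector
  \<open>(1 + s * cnj z)\<^sup>\<mu>\<^sup>-\<^sup>k (s - z)\<^sup>k\<close>.
\<close>

section \<open>Invariance of Lebesgue measure under orthogonal transformations\<close>

lemma borel_measurable_orthogonal_transformation:
  fixes g :: "'a::euclidean_space \<Rightarrow> 'a"
  assumes "orthogonal_transformation g"
  shows "g \<in> borel_measurable borel"
  using assms
  by (intro borel_measurable_continuous_onI linear_continuous_on)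
    (simp add: orthogonal_transformation_linear flip: linear_conv_bounded_linear)

lemma nn_integral_lborel_translate:
  fixes h :: "'a::euclidean_space \<Rightarrow> ennreal"
  assumes [measurable]: "h \<in> borel_measurable borel"
  shows "(\<integral>\<^sup>+x. h (a + x) \<partial>lborel) = (\<integral>\<^sup>+x. h x \<partial>lborel)"
  by (subst lborel_distr_plus[of a, symmetric], subst nn_integral_distr) auto

lemma nn_integral_indicator_ball_diff_orthogonal:
  fixes g :: "'a::euclidean_space \<Rightarrow> 'a"
  assumes g: "orthogonal_transformation g"
  shows "(\<integral>\<^sup>+x. indicator (ball 0 r) (y - g x) \<partial>lborel) = emeasure lborel (ball (0::'a) r)"
proof -
  obtain x\<^sub>0 where x\<^sub>0: "y = g x\<^sub>0" using orthogonal_transformation_surj[OF g] by (metis surjD)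
  have "norm (g x\<^sub>0 - g x) = norm (- x\<^sub>0 + x)" for x
    using orthogonal_transformation_norm[OF g, of "x\<^sub>0 - x"] orthogonal_transformation_linear[OF g]
    by (simp add: linear_diff norm_minus_commute)
  then have "indicator (ball 0 r) (y - g x) = (indicator (ball 0 r) (- x\<^sub>0 + x) :: ennreal)" for x
    by (simp add: x\<^sub>0 indicator_def)
  then show ?thesis
    using nn_integral_lborel_translate[OF borel_measurable_indicator, of "ball 0 r" "- x\<^sub>0"] by simp
qed

text \<open>
  Both \<open>f\<close> and \<open>f \<circ> g\<close> are averaged over the unit ball; Fubini's theorem and the translation
  invariance of Lebesgue measure exchange the two averages.
\<close>

lemma nn_integral_lborel_orthogonal_transformation:
  fixes g :: "'a::euclidean_space \<Rightarrow> 'a"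
  assumes g: "orthogonal_transformation g" and [measurable]: "f \<in> borel_measurable borel"
  shows "(\<integral>\<^sup>+x. f (g x) \<partial>lborel) = (\<integral>\<^sup>+x. f x \<partial>lborel)"
proof -
  define B where "B = ball (0::'a) 1"
  have [measurable]: "B \<in> sets borel" by (simp add: B_def)
  note [measurable] = borel_measurable_orthogonal_transformation[OF g]
  have "(\<integral>\<^sup>+x. f (g x) \<partial>lborel) * emeasure lborel B =
      (\<integral>\<^sup>+y. \<integral>\<^sup>+x. indicator B y * f (g x) \<partial>lborel \<partial>lborel)"
    by (simp add: nn_integral_cmult nn_integral_multc mult.commute)
  also have "\<dots> = (\<integral>\<^sup>+y. \<integral>\<^sup>+x. indicator B y * f (y + g x) \<partial>lborel \<partial>lborel)"
  proof (rule nn_integral_cong)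
    fix y
    obtain y' where "y = g y'" using orthogonal_transformation_surj[OF g] by (metis surjD)
    then show "(\<integral>\<^sup>+x. indicator B y * f (g x) \<partial>lborel) = (\<integral>\<^sup>+x. indicator B y * f (y + g x) \<partial>lborel)"
      using nn_integral_lborel_translate[of "\<lambda>x. indicator B y * f (g x)" y']
        linear_add[OF orthogonal_transformation_linear[OF g]] by simp
  qed
  also have "\<dots> = (\<integral>\<^sup>+x. \<integral>\<^sup>+y. indicator B y * f (y + g x) \<partial>lborel \<partial>lborel)"
    by (rule lborel_pair.Fubini') measurable
  also have "\<dots> = (\<integral>\<^sup>+x. \<integral>\<^sup>+y. indicator B (y - g x) * f y \<partial>lborel \<partial>lborel)"
  proof (rule nn_integral_cong)
    fix x
    show "(\<integral>\<^sup>+y. indicator B y * f (y + g x) \<partial>lborel) = (\<integral>\<^sup>+y. indicator B (y - g x) * f y \<partial>lborel)"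
      using nn_integral_lborel_translate[of "\<lambda>y. indicator B (y - g x) * f y" "g x"]
      by (simp add: add.commute)
  qed
  also have "\<dots> = (\<integral>\<^sup>+y. \<integral>\<^sup>+x. indicator B (y - g x) * f y \<partial>lborel \<partial>lborel)"
    by (rule lborel_pair.Fubini'[symmetric]) measurable
  finally have "(\<integral>\<^sup>+x. f (g x) \<partial>lborel) * emeasure lborel B = (\<integral>\<^sup>+x. f x \<partial>lborel) * emeasure lborel B"
    by (simp add: nn_integral_multc)
      (simp add: B_def nn_integral_indicator_ball_diff_orthogonal[OF g] nn_integral_multc mult.commute)
  moreover have "emeasure lborel B \<noteq> 0" "emeasure lborel B \<noteq> top"
    using emeasure_lborel_ball_finite[of "0::'a" 1] unit_ball_vol_pos[of "real DIM('a)"]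
    by (simp_all add: B_def emeasure_ball del: unit_ball_vol_pos)
  ultimately show ?thesis by (metis ennreal_mult_divide_eq)
qed

lemma distr_lborel_orthogonal_transformation:
  fixes g :: "'a::euclidean_space \<Rightarrow> 'a"
  assumes g: "orthogonal_transformation g"
  shows "distr lborel borel g = lborel"
proof (rule measure_eqI)
  note [measurable] = borel_measurable_orthogonal_transformation[OF g]
  fix A assume "A \<in> sets (distr lborel borel g)"
  then have [measurable]: "A \<in> sets borel" by simp
  have "emeasure (distr lborel borel g) A = (\<integral>\<^sup>+x. indicator A (g x) \<partial>lborel)"
    by (simp add: nn_integral_distr flip: nn_integral_indicator)
  then show "emeasure (distr lborel borel g) A = emeasure lborel A"
    by (simp add: nn_integral_lborel_orthogonal_transformation[OF g])
qed simp

lemma orthogonal_transformation_mult_complex: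
  assumes "cmod c = 1"
  shows "orthogonal_transformation (\<lambda>z. c * z)"
  unfolding orthogonal_transformation
  using assms by (auto simp: norm_mult intro: linearI algebra_simps)

lemma distr_lborel_norm_power:
  "distr lborel borel (\<lambda>x::'a::euclidean_space. norm x ^ DIM('a)) =
    density lborel (\<lambda>t. ennreal (unit_ball_vol (real DIM('a))) * indicator {0..} t)" (is "?D = ?P")
proof (rule measure_eqI_generator_eq[where E = "range (\<lambda>a::real. {..a})"
      and A = "\<lambda>n. {..real n}" and \<Omega> = UNIV])
  define V where "V = unit_ball_vol (real DIM('a))"
  have D: "emeasure ?D {..a} = (if a < 0 then 0 else ennreal (V * a))" for a
  proof -
    have "norm x ^ DIM('a) \<le> a \<longleftrightarrow> x \<in> (if a < 0 then {} else cball 0 (root DIM('a) a))" for x :: 'a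
      using real_root_le_iff[of "DIM('a)" "norm x ^ DIM('a)" a] zero_le_power[of "norm x" "DIM('a)"]
      by (auto simp: real_root_power_cancel simp del: zero_le_power)
    then have "(\<lambda>x::'a. norm x ^ DIM('a)) -` {..a} = (if a < 0 then {} else cball 0 (root DIM('a) a))"
      by blast
    then show ?thesis
      by (subst emeasure_distr) (auto simp: emeasure_cball V_def)
  qed
  have P: "emeasure ?P {..a} = (if a < 0 then 0 else ennreal (V * a))" for a
  proof -
    have "emeasure ?P {..a} = (\<integral>\<^sup>+t. ennreal V * indicator {0..a} t \<partial>lborel)"
      unfolding V_def by (subst emeasure_density) (auto intro!: nn_integral_cong split: split_indicator)
    also have "\<dots> = ennreal V * emeasure lborel {0..a}"
      by (subst nn_integral_cmult) auto
    finally show ?thesis by (auto simp: V_def ennreal_mult)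
  qed
  show "emeasure ?D X = emeasure ?P X" if "X \<in> range (\<lambda>a. {..a})" for X
    using that D P by auto
  show "emeasure ?D {..real i} \<noteq> \<infinity>" for i unfolding D by simp
  show "Int_stable (range (\<lambda>a::real. {..a}))" by (auto simp: Int_stable_def)
  show "(\<Union>i. {..real i}) = UNIV" using real_arch_simple by auto
qed (auto simp: borel_eq_atMost[where 'a = real])

section \<open>The measure on the sphere\<close>

lemma one_plus_cmod_square_pos [simp]: "0 < 1 + (cmod z)^2"
  by (simp add: add_pos_nonneg)

lemma one_plus_cmod_square_neq_0 [simp]: "1 + (cmod z)^2 \<noteq> 0"
  using one_plus_cmod_square_pos[of z] by linarith

lemma cnj_measurable [measurable]: "cnj \<in> borel_measurable borel"
  by (intro borel_measurable_continuous_onI continuous_intros)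

lemma iota_dens_nonneg [simp]: "0 \<le> iota_dens \<tau> z"
  by (simp add: iota_dens_def)

lemma iota_dens_measurable [measurable]: "iota_dens \<tau> \<in> borel_measurable borel"
  unfolding iota_dens_def by measurable

lemma sets_iota [simp, measurable_cong]: "sets (iota \<tau>) = sets borel"
  by (simp add: iota_def)

lemma space_iota [simp]: "space (iota \<tau>) = UNIV"
  by (simp add: iota_def)

lemma measurable_iota [simp]: "borel_measurable (iota \<tau>) = borel_measurable borel"
  by (rule measurable_cong_sets) simp_all

lemma sigma_finite_iota: "sigma_finite_measure (iota \<tau>)"
  unfolding iota_def
  by (subst sigma_finite_measure.sigma_finite_iff_density_finite[OF sigma_finite_lborel]) auto

lemma AE_iota_nonzero: "AE z in iota \<tau>. z \<noteq> 0"
  unfolding iota_def using AE_lborel_singleton[of "0::complex"] by (subst AE_density) auto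

lemma distr_iota_rotation:
  assumes "cmod c = 1"
  shows "distr (iota \<tau>) borel (\<lambda>z. c * z) = iota \<tau>"
proof -
  have "iota \<tau> = density (distr lborel borel (\<lambda>z. c * z)) (\<lambda>z. ennreal (iota_dens \<tau> z))"
    by (simp add: iota_def distr_lborel_orthogonal_transformation
      orthogonal_transformation_mult_complex assms)
  also have "\<dots> = distr (density lborel (\<lambda>z. ennreal (iota_dens \<tau> (c * z)))) borel (\<lambda>z. c * z)"
    by (subst density_distr) auto
  finally show ?thesis using assms by (simp add: iota_def iota_dens_def norm_mult)
qed

lemma distr_iota_cmod_square:
  "distr (iota \<tau>) borel (\<lambda>z. (cmod z)^2) =
    density lborel (\<lambda>t. ennreal ((real \<tau> + 1) / (1 + t) ^ (\<tau> + 2)) * indicator {0..} t)"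
proof -
  define d where "d = (\<lambda>t::real. (real \<tau> + 1) / (1 + t) ^ (\<tau> + 2))"
  have [measurable]: "d \<in> borel_measurable borel" unfolding d_def by measurable
  have "iota_dens \<tau> z = d ((cmod z)^2) / pi" for z
    by (simp add: iota_dens_def d_def power_add power2_eq_square)
  then have "distr (iota \<tau>) borel (\<lambda>z. (cmod z)^2) =
      density (distr lborel borel (\<lambda>z::complex. (cmod z)^2)) (\<lambda>t. ennreal (d t / pi))"
    unfolding iota_def by (subst density_distr) auto
  also have "\<dots> = density lborel (\<lambda>t. ennreal pi * indicator {0..} t * ennreal (d t / pi))"
    using distr_lborel_norm_power[where 'a = complex] by (simp add: unit_ball_vol_2 density_density_eq)
  also have "\<dots> = density lborel (\<lambda>t. ennreal (d t) * indicator {0..} t)"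
  proof (rule density_cong)
    have "ennreal pi * ennreal (d t / pi) = ennreal (d t)" for t
      by (simp flip: ennreal_mult')
    then show "AE t in lborel. ennreal pi * indicator {0..} t * ennreal (d t / pi) =
        ennreal (d t) * indicator {0..} t"
      by (simp split: split_indicator)
  qed auto
  finally show ?thesis by (simp only: d_def)
qed

lemma emeasure_iota_cmod_square_greaterThan:
  assumes r: "0 \<le> r"
  shows "emeasure (iota \<tau>) {z. r < (cmod z)^2} = ennreal (1 / (1 + r) ^ (\<tau> + 1))"
proof -
  define d where "d = (\<lambda>t::real. (real \<tau> + 1) / (1 + t) ^ (\<tau> + 2))"
  have [measurable]: "d \<in> borel_measurable borel" unfolding d_def by measurable
  have "emeasure (iota \<tau>) {z. r < (cmod z)^2} = emeasure (distr (iota \<tau>) borel (\<lambda>z. (cmod z)^2)) {r<..}"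
    by (subst emeasure_distr) (auto simp: vimage_def)
  also have "\<dots> = (\<integral>\<^sup>+t. ennreal (d t) * indicator {0..} t * indicator {r<..} t \<partial>lborel)"
    unfolding distr_iota_cmod_square d_def by (subst emeasure_density) auto
  also have "\<dots> = (\<integral>\<^sup>+t. ennreal (d t) * indicator {r..} t \<partial>lborel)"
    using AE_lborel_singleton[of r] r by (intro nn_integral_cong_AE) (auto split: split_indicator)
  also have "\<dots> = ennreal (0 - (- 1 / (1 + r) ^ (\<tau> + 1)))"
  proof (rule nn_integral_FTC_atLeast)
    show "((\<lambda>t. - 1 / (1 + t) ^ (\<tau> + 1)) has_real_derivative d t) (at t)" if "r \<le> t" for t
      unfolding d_def using that r
      by (auto intro!: derivative_eq_intros simp: divide_simps simp flip: power_Suc)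
        (simp add: algebra_simps)
    show "((\<lambda>t::real. - 1 / (1 + t) ^ (\<tau> + 1)) \<longlongrightarrow> 0) at_top"
      by real_asymp
  qed (use r in \<open>auto simp: d_def\<close>)
  finally show ?thesis by simp
qed

lemma emeasure_iota_UNIV: "emeasure (iota \<tau>) UNIV = 1"
proof -
  have "emeasure (iota \<tau>) UNIV = emeasure (iota \<tau>) {z. 0 < (cmod z)^2}"
    using AE_iota_nonzero by (intro emeasure_eq_AE) auto
  then show ?thesis using emeasure_iota_cmod_square_greaterThan[of 0] by simp
qed

definition sphere_coord :: "complex \<Rightarrow> real" where
  "sphere_coord z = (cmod z)^2 / (1 + (cmod z)^2)"

lemma sphere_coord_nonneg [simp]: "0 \<le> sphere_coord z"
  and sphere_coord_less_1 [simp]: "sphere_coord z < 1"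
  by (simp_all add: sphere_coord_def)

lemma sphere_coord_measurable [measurable]: "sphere_coord \<in> borel_measurable borel"
  unfolding sphere_coord_def by measurable

lemma less_sphere_coord_iff:
  assumes "c < 1"
  shows "c < sphere_coord z \<longleftrightarrow> c / (1 - c) < (cmod z)^2"
  unfolding sphere_coord_def using assms by (simp add: field_simps)

lemma distr_iota_sphere_coord: "distr (iota 0) borel sphere_coord = density lborel (indicator {0..1})"
proof (rule measure_eqI_lessThan)
  have sphere: "emeasure (distr (iota 0) borel sphere_coord) {c<..} =
      emeasure (iota 0) {z. c < sphere_coord z}" for c
    by (subst emeasure_distr) (auto simp: vimage_def)
  show "emeasure (distr (iota 0) borel sphere_coord) {c<..} < \<infinity>" for c
    using emeasure_space[of "iota 0" "{z. c < sphere_coord z}"]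
    by (simp add: sphere emeasure_iota_UNIV less_top) (metis ennreal_one_less_top leD less_top)
  fix c :: real
  have interval: "emeasure (density lborel (indicator {0..1})) {c<..} =
      emeasure lborel ({0..1} \<inter> {c<..})"
    by (subst emeasure_density) (auto simp: indicator_inter_arith[symmetric])
  have "emeasure (iota 0) {z. c < sphere_coord z} = emeasure lborel ({0..1} \<inter> {c<..})"
  proof -
    consider (neg) "c < 0" | (unit) "0 \<le> c" "c < 1" | (ge_1) "1 \<le> c" by linarith
    then show ?thesis
    proof cases
      case neg
      then have "{z. c < sphere_coord z} = UNIV" "{0..1} \<inter> {c<..} = {0..1}"
        by (auto intro: less_le_trans)
      then show ?thesis by (simp add: emeasure_iota_UNIV)
    next
      case unit
      then have "{0..1} \<inter> {c<..} = {c<..1}" "1 / (1 + c / (1 - c)) = 1 - c"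
        by (auto simp: field_simps)
      then show ?thesis
        using unit by (simp add: less_sphere_coord_iff emeasure_iota_cmod_square_greaterThan)
    next
      case ge_1
      then have "{z. c < sphere_coord z} = {}" "{0..1} \<inter> {c<..} = {}"
        using order.strict_trans2[OF sphere_coord_less_1] by (auto simp: not_less intro: less_imp_le)
      then show ?thesis by simp
    qed
  qed
  then show "emeasure (distr (iota 0) borel sphere_coord) {c<..} =
      emeasure (density lborel (indicator {0..1})) {c<..}"
    by (simp only: sphere interval)
qed auto

lemma integral_iota_rotation:
  fixes g :: "complex \<Rightarrow> 'a::{banach, second_countable_topology}"
  assumes "g \<in> borel_measurable borel" and "cmod c = 1"
  shows "(LINT z|iota \<tau>. g (c * z)) = (LINT z|iota \<tau>. g z)"
proof -
  have "(LINT z|iota \<tau>. g z) = (LINT z|distr (iota \<tau>) borel (\<lambda>z. c * z). g z)"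
    by (simp add: distr_iota_rotation assms(2))
  also have "\<dots> = (LINT z|iota \<tau>. g (c * z))"
    using assms(1) by (intro integral_distr) auto
  finally show ?thesis by simp
qed

lemma integral_iota_sphere_coord:
  fixes \<phi> :: "real \<Rightarrow> 'a::euclidean_space"
  assumes "continuous_on UNIV \<phi>"
  shows "(LINT z|iota 0. \<phi> (sphere_coord z)) = integral {0..1} \<phi>"
proof -
  have [measurable]: "\<phi> \<in> borel_measurable borel"
    using assms by (rule borel_measurable_continuous_onI)
  have "(LINT z|iota 0. \<phi> (sphere_coord z)) =
      (LINT x|density lborel (\<lambda>x. ennreal (indicator {0..1} x)). \<phi> x)"
    by (subst integral_distr[of sphere_coord _ borel, symmetric])
      (simp_all add: distr_iota_sphere_coord ennreal_indicator)
  also have "\<dots> = (LINT x:{0..1}|lborel. \<phi> x)"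
    unfolding set_lebesgue_integral_def by (subst integral_density) auto
  also have "\<dots> = integral {0..1} \<phi>"
    using assms by (intro set_borel_integral_eq_integral borel_integrable_atLeastAtMost')
      (auto intro: continuous_on_subset)
  finally show ?thesis .
qed

lemma sgn_measurable_complex [measurable]: "(sgn :: complex \<Rightarrow> complex) \<in> borel_measurable borel"
  unfolding sgn_div_norm by measurable

lemma sgn_mult_cnj: "z \<noteq> 0 \<Longrightarrow> sgn z * cnj (sgn z) = 1"
  by (simp add: norm_sgn flip: complex_norm_square)

lemma obtain_rotation_sign_change:
  assumes "p \<noteq> q"
  obtains c :: complex where "cmod c = 1" "c ^ p * cnj c ^ q = -1"
proof -
  define x where "x = pi / (real p - real q)"
  have "cis x ^ p * cnj (cis x) ^ q = cis (real p * x + real q * - x)"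
    by (simp only: cis_cnj Complex.DeMoivre cis_mult)
  also have "real p * x + real q * - x = (real p - real q) * x" by (simp add: algebra_simps)
  also have "\<dots> = pi" using assms by (simp add: x_def)
  finally show thesis using that[of "cis x"] by simp
qed

lemma integral_iota_polar:
  fixes \<phi> :: "real \<Rightarrow> complex"
  assumes \<phi>: "continuous_on UNIV \<phi>"
  shows "(LINT z|iota 0. \<phi> (sphere_coord z) * (sgn z ^ p * cnj (sgn z) ^ q)) =
    (if p = q then integral {0..1} \<phi> else 0)"
proof -
  have [measurable]: "\<phi> \<in> borel_measurable borel"
    using assms by (rule borel_measurable_continuous_onI)
  show ?thesis
  proof (cases "p = q")
    case True
    have "(LINT z|iota 0. \<phi> (sphere_coord z) * (sgn z ^ p * cnj (sgn z) ^ p)) =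
        (LINT z|iota 0. \<phi> (sphere_coord z))"
    proof (rule integral_cong_AE)
      show "AE z in iota 0. \<phi> (sphere_coord z) * (sgn z ^ p * cnj (sgn z) ^ p) = \<phi> (sphere_coord z)"
        using AE_iota_nonzero by eventually_elim (simp add: sgn_mult_cnj flip: power_mult_distrib)
    qed auto
    then show ?thesis using True by (simp add: integral_iota_sphere_coord[OF \<phi>])
  next
    case False
    then obtain c where norm_c: "cmod c = 1" and c: "c ^ p * cnj c ^ q = -1"
      by (rule obtain_rotation_sign_change)
    have sgn_rotated: "sgn (c * z) = c * sgn z" for z by (simp add: sgn_eq norm_mult norm_c)
    have "sgn (c * z) ^ p * cnj (sgn (c * z)) ^ q =
        (c ^ p * cnj c ^ q) * (sgn z ^ p * cnj (sgn z) ^ q)" for z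
      unfolding sgn_rotated complex_cnj_mult power_mult_distrib by (simp only: mult_ac)
    then have rotated: "\<phi> (sphere_coord (c * z)) * (sgn (c * z) ^ p * cnj (sgn (c * z)) ^ q) =
        - (\<phi> (sphere_coord z) * (sgn z ^ p * cnj (sgn z) ^ q))" for z
      by (simp only: c) (simp add: sphere_coord_def norm_mult norm_c)
    have "(LINT z|iota 0. \<phi> (sphere_coord z) * (sgn z ^ p * cnj (sgn z) ^ q)) =
        (LINT z|iota 0. \<phi> (sphere_coord (c * z)) * (sgn (c * z) ^ p * cnj (sgn (c * z)) ^ q))"
      by (rule integral_iota_rotation[OF _ norm_c, symmetric]) measurable
    then show ?thesis using False by (simp add: rotated)
  qed
qed

definition iota_weight :: "nat \<Rightarrow> complex \<Rightarrow> real" where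
  "iota_weight \<tau> z = (real \<tau> + 1) / (1 + (cmod z)^2) ^ \<tau>"

lemma iota_weight_nonneg [simp]: "0 \<le> iota_weight \<tau> z"
  by (simp add: iota_weight_def)

lemma iota_weight_measurable [measurable]: "iota_weight \<tau> \<in> borel_measurable borel"
  unfolding iota_weight_def by measurable

lemma iota_eq_density: "iota \<tau> = density (iota 0) (\<lambda>z. ennreal (iota_weight \<tau> z))"
proof -
  have "iota_dens \<tau> z = iota_dens 0 z * iota_weight \<tau> z" for z
    by (simp add: iota_dens_def iota_weight_def)
  then show ?thesis
    unfolding iota_def by (subst density_density_eq) (auto simp flip: ennreal_mult)
qed

lemma
  fixes g :: "complex \<Rightarrow> 'a::{banach, second_countable_topology}"
  assumes "g \<in> borel_measurable borel"
  shows integral_iota_eq: "(LINT z|iota \<tau>. g z) = (LINT z|iota 0. iota_weight \<tau> z *\<^sub>R g z)"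
    and integrable_iota_iff: "integrable (iota \<tau>) g \<longleftrightarrow> integrable (iota 0) (\<lambda>z. iota_weight \<tau> z *\<^sub>R g z)"
  unfolding iota_eq_density[of \<tau>] using assms by (simp_all add: integral_density integrable_density)

lemma integrable_iota_bound:
  fixes g :: "complex \<Rightarrow> 'a::{banach, second_countable_topology}"
  assumes [measurable]: "g \<in> borel_measurable borel"
    and bound: "\<And>z. norm (g z) \<le> K * (1 + (cmod z)^2) ^ \<tau>"
  shows "integrable (iota \<tau>) g"
proof -
  interpret finite_measure "iota 0" by (rule finite_measureI) (simp add: emeasure_iota_UNIV)
  have "norm (iota_weight \<tau> z *\<^sub>R g z) \<le> (real \<tau> + 1) * K" for z
    using mult_left_mono[OF bound[of z], of "iota_weight \<tau> z"] by (simp add: iota_weight_def)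
  then have "integrable (iota 0) (\<lambda>z. iota_weight \<tau> z *\<^sub>R g z)"
    by (intro integrable_const_bound[where B = "(real \<tau> + 1) * K"]) auto
  then show ?thesis by (subst integrable_iota_iff) auto
qed

lemma sqrt_sphere_coord: "sqrt (sphere_coord z) = cmod z / sqrt (1 + (cmod z)^2)"
  by (simp add: sphere_coord_def real_sqrt_divide)

lemma sqrt_one_minus_sphere_coord: "sqrt (1 - sphere_coord z) = 1 / sqrt (1 + (cmod z)^2)"
proof -
  have "1 - sphere_coord z = 1 / (1 + (cmod z)^2)" by (simp add: sphere_coord_def field_simps)
  then show ?thesis by (simp add: real_sqrt_divide)
qed

lemma monomial_polar:
  assumes "p + q \<le> m"
  shows "z ^ p * cnj z ^ q / of_real (sqrt (1 + (cmod z)^2) ^ m) =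
    of_real (sqrt (sphere_coord z) ^ (p + q) * sqrt (1 - sphere_coord z) ^ (m - (p + q))) *
      (sgn z ^ p * cnj (sgn z) ^ q)"
proof -
  define s where "s = sqrt (1 + (cmod z)^2)"
  have "z = of_real (cmod z) * sgn z" by (simp add: sgn_eq)
  then have "z ^ p * cnj z ^ q =
      (of_real (cmod z) * sgn z) ^ p * cnj (of_real (cmod z) * sgn z) ^ q" by simp
  also have "\<dots> = of_real (cmod z ^ (p + q)) * (sgn z ^ p * cnj (sgn z) ^ q)"
    by (simp only: complex_cnj_mult complex_cnj_complex_of_real power_mult_distrib power_add
      of_real_mult of_real_power mult_ac)
  finally have monomial: "z ^ p * cnj z ^ q =
      of_real (cmod z ^ (p + q)) * (sgn z ^ p * cnj (sgn z) ^ q)" .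
  have "s ^ m = s ^ (p + q) * s ^ (m - (p + q))"
    using assms by (simp flip: power_add)
  then have "cmod z ^ (p + q) / s ^ m =
      sqrt (sphere_coord z) ^ (p + q) * sqrt (1 - sphere_coord z) ^ (m - (p + q))"
    by (simp add: sqrt_sphere_coord sqrt_one_minus_sphere_coord s_def power_divide)
  then show ?thesis
    unfolding monomial s_def[symmetric] by (simp only: flip: times_divide_eq_left of_real_divide)
qed

section \<open>The orthonormal monomials\<close>

lemma has_integral_power_mult_power:
  "((\<lambda>x::real. x ^ p * (1 - x) ^ m) has_integral (fact p * fact m / fact (p + m + 1))) {0..1}"
proof -
  have "((\<lambda>t::real. t powr (real (p + 1) - 1) * (1 - t) powr (real (m + 1) - 1)) has_integral
      Beta (real (p + 1)) (real (m + 1))) {0..1}"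
    by (intro has_integral_Beta_real) auto
  moreover have "Beta (real (p + 1)) (real (m + 1)) = fact p * fact m / fact (p + m + 1)"
    using Gamma_fact[of p, where 'a = real] Gamma_fact[of m, where 'a = real]
      Gamma_fact[of "p + m + 1", where 'a = real]
    by (simp add: Beta_def add_ac)
  moreover have "t powr (real (p + 1) - 1) * (1 - t) powr (real (m + 1) - 1) = t ^ p * (1 - t) ^ m"
    if "t \<in> {0..1} - {0, 1}" for t :: real
    using that by (auto simp: powr_realpow)
  ultimately show ?thesis
    by (metis (no_types, lifting) has_integral_spike_finite finite.emptyI finite.insertI)
qed

lemma cmod_monomial_le:
  assumes "p \<le> \<tau>" "q \<le> \<tau>"
  shows "cmod (z ^ p * cnj z ^ q) \<le> (1 + (cmod z)^2) ^ \<tau>"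
proof -
  define s where "s = sqrt (1 + (cmod z)^2)"
  have s: "s \<ge> 1" "cmod z \<le> s" by (auto simp: s_def intro: real_le_rsqrt)
  have power_le: "cmod z ^ p \<le> s ^ \<tau>" if "p \<le> \<tau>" for p
    using s that by (meson power_mono power_increasing norm_ge_zero order_trans)
  have "cmod z ^ p * cmod z ^ q \<le> s ^ \<tau> * s ^ \<tau>"
    using s by (intro mult_mono power_le assms) auto
  also have "\<dots> = (1 + (cmod z)^2) ^ \<tau>" by (simp add: s_def flip: power_mult_distrib)
  finally show ?thesis by (simp add: norm_mult norm_power)
qed

lemma integrable_iota_monomial:
  assumes "p \<le> \<tau>" "q \<le> \<tau>"
  shows "integrable (iota \<tau>) (\<lambda>z. z ^ p * cnj z ^ q)"
  using cmod_monomial_le[OF assms] by (intro integrable_iota_bound[where K = 1]) simp_all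

lemma integral_iota_monomial:
  assumes p: "p \<le> \<tau>" and q: "q \<le> \<tau>"
  shows "(LINT z|iota \<tau>. z ^ p * cnj z ^ q) = (if p = q then 1 / of_nat (\<tau> choose p) else 0)"
proof -
  define \<phi> where "\<phi> = (\<lambda>x::real. complex_of_real (sqrt x ^ (p + q) * sqrt (1 - x) ^ (2 * \<tau> - (p + q))))"
  have \<phi>: "continuous_on UNIV \<phi>" unfolding \<phi>_def by (intro continuous_intros)
  have "iota_weight \<tau> z *\<^sub>R (z ^ p * cnj z ^ q) =
      (of_nat \<tau> + 1) * (\<phi> (sphere_coord z) * (sgn z ^ p * cnj (sgn z) ^ q))" for z
  proof -
    have "iota_weight \<tau> z *\<^sub>R (z ^ p * cnj z ^ q) =
        (of_nat \<tau> + 1) * (z ^ p * cnj z ^ q / of_real (sqrt (1 + (cmod z)^2) ^ (2 * \<tau>)))"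
      by (simp add: iota_weight_def power_mult scaleR_conv_of_real)
    then show ?thesis
      using p q by (simp only: monomial_polar \<phi>_def)
  qed
  then have polar: "(LINT z|iota \<tau>. z ^ p * cnj z ^ q) =
      (of_nat \<tau> + 1) * (if p = q then integral {0..1} \<phi> else 0)"
    by (simp add: integral_iota_eq integral_iota_polar[OF \<phi>])
  define beta :: real where "beta = fact p * fact (\<tau> - p) / fact (p + (\<tau> - p) + 1)"
  have "integral {0..1} \<phi> = of_real beta" if "q = p"
    unfolding beta_def
  proof (intro integral_unique
      has_integral_eq[OF _ has_integral_of_real[OF has_integral_power_mult_power]])
    fix x :: real assume x: "x \<in> {0..1}"
    have exponents: "p + q = 2 * p" "2 * \<tau> - 2 * p = 2 * (\<tau> - p)" using that by simp_all
    have "sqrt x ^ (p + q) = x ^ p" "sqrt (1 - x) ^ (2 * \<tau> - (p + q)) = (1 - x) ^ (\<tau> - p)"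
      unfolding exponents power_mult using x by simp_all
    then show "complex_of_real (x ^ p * (1 - x) ^ (\<tau> - p)) = \<phi> x"
      by (simp only: \<phi>_def)
  qed
  moreover have "(of_nat \<tau> + 1) * complex_of_real beta = 1 / of_nat (\<tau> choose p)"
  proof -
    have "(real \<tau> + 1) * beta = 1 / real (\<tau> choose p)"
      using p by (simp add: beta_def binomial_fact add.commute[of 1 "real \<tau>"])
    from arg_cong[OF this, of complex_of_real] show ?thesis by simp
  qed
  ultimately show ?thesis unfolding polar by simp
qed

lemma integral_mult_sum_mult_sum:
  fixes f :: "'a \<Rightarrow> 'b::{real_normed_field, banach, second_countable_topology}"
  assumes "\<And>i j. i \<in> I \<Longrightarrow> j \<in> J \<Longrightarrow> integrable M (\<lambda>x. f x * (e i x * g j x))"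
  shows "(LINT x|M. f x * ((\<Sum>i\<in>I. c i * e i x) * (\<Sum>j\<in>J. d j * g j x))) =
    (\<Sum>i\<in>I. \<Sum>j\<in>J. c i * d j * (LINT x|M. f x * (e i x * g j x)))"
proof -
  have "(LINT x|M. f x * ((\<Sum>i\<in>I. c i * e i x) * (\<Sum>j\<in>J. d j * g j x))) =
      (LINT x|M. (\<Sum>i\<in>I. \<Sum>j\<in>J. c i * d j * (f x * (e i x * g j x))))"
    by (simp only: sum_product) (simp add: sum_distrib_left mult_ac)
  also have "\<dots> = (\<Sum>i\<in>I. \<Sum>j\<in>J. LINT x|M. c i * d j * (f x * (e i x * g j x)))"
    using assms by (simp add: Bochner_Integration.integral_sum)
  finally show ?thesis by simp
qed

lemma integral_orthonormal_sum_mult_sum: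
  fixes e :: "'i \<Rightarrow> 'a \<Rightarrow> complex"
  assumes "finite I"
    and integrable: "\<And>i j. i \<in> I \<Longrightarrow> j \<in> I \<Longrightarrow> integrable M (\<lambda>x. e i x * cnj (e j x))"
    and orthonormal: "\<And>i j. i \<in> I \<Longrightarrow> j \<in> I \<Longrightarrow> (LINT x|M. e i x * cnj (e j x)) = (if i = j then 1 else 0)"
  shows "(LINT x|M. (\<Sum>i\<in>I. c i * e i x) * (\<Sum>i\<in>I. d i * cnj (e i x))) = (\<Sum>i\<in>I. c i * d i)"
proof -
  have "(LINT x|M. (\<Sum>i\<in>I. c i * e i x) * (\<Sum>i\<in>I. d i * cnj (e i x))) =
      (\<Sum>i\<in>I. \<Sum>j\<in>I. c i * d j * (LINT x|M. e i x * cnj (e j x)))"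
    using integral_mult_sum_mult_sum[of I I M "\<lambda>_. 1" e "\<lambda>j x. cnj (e j x)" c d] integrable by simp
  also have "\<dots> = (\<Sum>i\<in>I. \<Sum>j\<in>I. if i = j then c i * d j else 0)"
    by (intro sum.cong refl) (simp add: orthonormal)
  also have "\<dots> = (\<Sum>i\<in>I. c i * d i)"
    using assms(1) by simp
  finally show ?thesis .
qed

lemma onb_measurable [measurable]: "onb \<tau> j \<in> borel_measurable borel"
  unfolding onb_def by measurable

lemma onb_mult_cnj_onb:
  "onb \<tau> p x * cnj (onb \<tau> q z) =
    of_real (sqrt (real (\<tau> choose p)) * sqrt (real (\<tau> choose q))) * (x ^ p * cnj z ^ q)"
  by (simp add: onb_def)

lemma
  assumes "p \<le> \<tau>" "q \<le> \<tau>"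
  shows integrable_onb_mult_cnj_onb: "integrable (iota \<tau>) (\<lambda>z. onb \<tau> p z * cnj (onb \<tau> q z))"
    and integral_onb_mult_cnj_onb: "(LINT z|iota \<tau>. onb \<tau> p z * cnj (onb \<tau> q z)) =
        (if p = q then 1 else 0)"
  unfolding onb_mult_cnj_onb using assms
  by (simp_all add: integrable_iota_monomial integral_iota_monomial del: of_real_mult)

definition lincomb_onb :: "nat \<Rightarrow> (nat \<Rightarrow> complex) \<Rightarrow> complex \<Rightarrow> complex" where
  "lincomb_onb \<tau> c = (\<lambda>z. \<Sum>j\<le>\<tau>. c j * onb \<tau> j z)"

lemma lincomb_onb_cong: "(\<And>j. j \<le> \<tau> \<Longrightarrow> c j = d j) \<Longrightarrow> lincomb_onb \<tau> c = lincomb_onb \<tau> d"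
  by (simp add: lincomb_onb_def)

lemma onb_eq_lincomb_onb:
  assumes "j \<le> \<tau>"
  shows "onb \<tau> j = lincomb_onb \<tau> (\<lambda>i. if i = j then 1 else 0)"
proof
  fix z
  have "lincomb_onb \<tau> (\<lambda>i. if i = j then 1 else 0) z = (\<Sum>i\<le>\<tau>. if i = j then onb \<tau> i z else 0)"
    unfolding lincomb_onb_def by (intro sum.cong) auto
  then show "onb \<tau> j z = lincomb_onb \<tau> (\<lambda>i. if i = j then 1 else 0) z" using assms by simp
qed

lemma inner_H_lincomb_onb: "inner_H \<tau> (lincomb_onb \<tau> c) (lincomb_onb \<tau> d) = (\<Sum>j\<le>\<tau>. c j * cnj (d j))"
  unfolding inner_H_def lincomb_onb_def
  using integral_orthonormal_sum_mult_sum[of "{..\<tau>}" "iota \<tau>" "onb \<tau>" c "\<lambda>j. cnj (d j)"]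
  by (simp add: integrable_onb_mult_cnj_onb integral_onb_mult_cnj_onb)

section \<open>Matrices of operators\<close>

definition has_matrix ::
    "nat \<Rightarrow> ((complex \<Rightarrow> complex) \<Rightarrow> complex \<Rightarrow> complex) \<Rightarrow> (nat \<Rightarrow> nat \<Rightarrow> complex) \<Rightarrow> bool" where
  "has_matrix \<tau> A M \<longleftrightarrow> (\<forall>c. A (lincomb_onb \<tau> c) = lincomb_onb \<tau> (\<lambda>i. \<Sum>j\<le>\<tau>. M i j * c j))"

definition mat_mult :: "nat \<Rightarrow> (nat \<Rightarrow> nat \<Rightarrow> 'a) \<Rightarrow> (nat \<Rightarrow> nat \<Rightarrow> 'a) \<Rightarrow> nat \<Rightarrow> nat \<Rightarrow> 'a::semiring_1" where
  "mat_mult N A B i j = (\<Sum>l\<le>N. A i l * B l j)"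

primrec mat_power :: "nat \<Rightarrow> (nat \<Rightarrow> nat \<Rightarrow> 'a) \<Rightarrow> nat \<Rightarrow> nat \<Rightarrow> nat \<Rightarrow> 'a::semiring_1" where
  "mat_power N A 0 = (\<lambda>i j. if i = j then 1 else 0)"
| "mat_power N A (Suc n) = mat_mult N A (mat_power N A n)"

lemma has_matrix_mult:
  assumes "has_matrix \<tau> A M" "has_matrix \<tau> B M'"
  shows "has_matrix \<tau> (A \<circ> B) (mat_mult \<tau> M M')"
proof -
  have "(\<Sum>l\<le>\<tau>. M i l * (\<Sum>j\<le>\<tau>. M' l j * c j)) = (\<Sum>j\<le>\<tau>. mat_mult \<tau> M M' i j * c j)" for i c
    unfolding mat_mult_def sum_distrib_left sum_distrib_right
    by (subst sum.swap) (simp only: mult.assoc)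
  then show ?thesis using assms by (simp add: has_matrix_def)
qed

lemma has_matrix_funpow: "has_matrix \<tau> A M \<Longrightarrow> has_matrix \<tau> (A ^^ n) (mat_power \<tau> M n)"
proof (induction n)
  case 0
  have "(\<Sum>j\<le>\<tau>. (if i = j then 1 else 0) * c j) = c i" if "i \<le> \<tau>" for i and c :: "nat \<Rightarrow> complex"
  proof -
    have "(\<Sum>j\<le>\<tau>. (if i = j then 1 else 0) * c j) = (\<Sum>j\<le>\<tau>. if i = j then c j else 0)"
      by (intro sum.cong) auto
    then show ?thesis using that by simp
  qed
  then show ?case by (auto simp: has_matrix_def intro: lincomb_onb_cong)
qed (simp add: has_matrix_mult)

lemma trace_H_has_matrix:
  assumes "has_matrix \<tau> A M"
  shows "trace_H \<tau> A = (\<Sum>j\<le>\<tau>. M j j)"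
  unfolding trace_H_def
proof (rule sum.cong[OF refl])
  fix j assume "j \<in> {..\<tau>}"
  then have j: "j \<le> \<tau>" by simp
  have "inner_H \<tau> (A (onb \<tau> j)) (onb \<tau> j) =
      (\<Sum>i\<le>\<tau>. (\<Sum>l\<le>\<tau>. M i l * (if l = j then 1 else 0)) * (if i = j then 1 else 0))"
    using assms unfolding onb_eq_lincomb_onb[OF j] has_matrix_def
    by (simp add: inner_H_lincomb_onb if_distrib cong: if_cong)
  also have "\<dots> = M j j"
    using j by (simp add: if_distrib[where f = "(*) _"] cong: if_cong)
  finally show "inner_H \<tau> (A (onb \<tau> j)) (onb \<tau> j) = M j j" .
qed

lemma power_mult_one_plus_power:
  fixes y s :: "'a::comm_semiring_1"
  assumes "l + m \<le> n"
  shows "s ^ l * (1 + y * s) ^ m =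
      (\<Sum>a\<le>n. (if l \<le> a then of_nat (m choose (a - l)) * y ^ (a - l) else 0) * s ^ a)"
proof -
  define F where "F = (\<lambda>a. (if l \<le> a then of_nat (m choose (a - l)) * y ^ (a - l) else 0) * s ^ a)"
  have "sum F {..n} = sum F {l..l + m}"
    by (rule sum.mono_neutral_right)
      (use assms in \<open>auto simp: F_def binomial_eq_0 not_le less_diff_conv add.commute\<close>)
  also have "\<dots> = (\<Sum>t\<le>m. of_nat (m choose t) * y ^ t * s ^ (t + l))"
    by (rule sum.reindex_bij_witness[where i = "\<lambda>t. t + l" and j = "\<lambda>a. a - l"]) (auto simp: F_def)
  also have "\<dots> = s ^ l * (\<Sum>t\<le>m. of_nat (m choose t) * (y * s) ^ t)"
    by (simp add: sum_distrib_left power_mult_distrib power_add mult_ac)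
  also have "(\<Sum>t\<le>m. of_nat (m choose t) * (y * s) ^ t) = (1 + y * s) ^ m"
    using binomial_ring[of "y * s" 1 m] by (simp add: add.commute)
  finally show ?thesis by (simp add: F_def)
qed

lemma reproducing_kernel_onb: "(1 + x * cnj z) ^ \<tau> = (\<Sum>j\<le>\<tau>. onb \<tau> j x * cnj (onb \<tau> j z))"
proof -
  have "(1 + x * cnj z) ^ \<tau> = (\<Sum>j\<le>\<tau>. of_nat (\<tau> choose j) * x ^ j * cnj z ^ j)"
    using power_mult_one_plus_power[of 0 \<tau> \<tau> "cnj z" x] by simp
  also have "\<dots> = (\<Sum>j\<le>\<tau>. onb \<tau> j x * cnj (onb \<tau> j z))"
    by (simp add: onb_mult_cnj_onb mult.assoc del: of_real_mult)
  finally show ?thesis .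
qed

definition Rstar_matrix :: "nat \<Rightarrow> (complex \<Rightarrow> complex) \<Rightarrow> nat \<Rightarrow> nat \<Rightarrow> complex" where
  "Rstar_matrix \<mu> f a a' = 1 / (of_nat \<mu> + 1) * (LINT z|iota \<mu>. f z * (onb \<mu> a' z * cnj (onb \<mu> a z)))"

lemma integrable_bounded_mult:
  fixes f g :: "'a \<Rightarrow> 'b::{real_normed_algebra, banach, second_countable_topology}"
  assumes [measurable]: "f \<in> borel_measurable M" and "bounded (range f)" and g: "integrable M g"
  shows "integrable M (\<lambda>x. f x * g x)"
proof -
  obtain K where K: "K > 0" "\<And>x. norm (f x) \<le> K" using assms(2) by (auto simp: bounded_pos)
  show ?thesis
  proof (rule Bochner_Integration.integrable_bound)
    show "integrable M (\<lambda>x. K *\<^sub>R g x)" using g by simp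
    have "norm (f x * g x) \<le> norm (K *\<^sub>R g x)" for x
      using norm_mult_ineq[of "f x" "g x"] mult_right_mono[OF K(2)[of x], of "norm (g x)"] K(1) by simp
    then show "AE x in M. norm (f x * g x) \<le> norm (K *\<^sub>R g x)" by simp
  qed (use g in measurable)
qed

lemma bounded_range_tendsto_at_infinity:
  fixes f :: "'a::{real_normed_vector, heine_borel} \<Rightarrow> 'b::real_normed_vector"
  assumes cont: "continuous_on UNIV f" and "(f \<longlongrightarrow> L) at_infinity"
  shows "bounded (range f)"
proof -
  have "\<forall>\<^sub>F z in at_infinity. norm (f z) < norm L + 1"
    using tendsto_norm[OF assms(2)] by (rule order_tendstoD) simp
  then obtain r where "\<And>z. r \<le> norm z \<Longrightarrow> norm (f z) < norm L + 1"
    by (auto simp: eventually_at_infinity)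
  then have "bounded (f ` {z. r \<le> norm z})"
    unfolding bounded_iff by (force intro: less_imp_le)
  moreover have "bounded (f ` cball 0 r)"
    by (intro compact_imp_bounded compact_continuous_image continuous_on_subset[OF cont]) auto
  moreover have "{z. r \<le> norm z} \<union> cball 0 r = (UNIV :: 'a set)" by auto
  ultimately show ?thesis by (metis bounded_Un image_Un)
qed

lemma integral_mult_sum_onb_sum_cnj_onb:
  assumes f: "f \<in> borel_measurable borel" "bounded (range f)"
  shows "1 / (of_nat \<mu> + 1) *
      (LINT z|iota \<mu>. f z * ((\<Sum>j\<le>\<mu>. c j * onb \<mu> j z) * (\<Sum>i\<le>\<mu>. d i * cnj (onb \<mu> i z)))) =
    (\<Sum>i\<le>\<mu>. \<Sum>j\<le>\<mu>. Rstar_matrix \<mu> f i j * c j * d i)"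
proof -
  have "integrable (iota \<mu>) (\<lambda>z. f z * (onb \<mu> j z * cnj (onb \<mu> i z)))" if "i \<le> \<mu>" "j \<le> \<mu>" for i j
    using f that by (intro integrable_bounded_mult integrable_onb_mult_cnj_onb) auto
  then have "(LINT z|iota \<mu>. f z * ((\<Sum>j\<le>\<mu>. c j * onb \<mu> j z) * (\<Sum>i\<le>\<mu>. d i * cnj (onb \<mu> i z)))) =
      (\<Sum>j\<le>\<mu>. \<Sum>i\<le>\<mu>. c j * d i * (LINT z|iota \<mu>. f z * (onb \<mu> j z * cnj (onb \<mu> i z))))"
    by (intro integral_mult_sum_mult_sum) auto
  then show ?thesis
    unfolding Rstar_matrix_def by (subst sum.swap) (simp add: sum_distrib_left mult_ac)
qed

lemma has_matrix_Rstar: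
  assumes "f \<in> borel_measurable borel" "bounded (range f)"
  shows "has_matrix \<mu> (Rstar \<mu> f) (Rstar_matrix \<mu> f)"
  unfolding has_matrix_def
proof (intro allI ext)
  fix c x
  have "Rstar \<mu> f (lincomb_onb \<mu> c) x =
      1 / (of_nat \<mu> + 1) *
        (LINT z|iota \<mu>. f z * ((\<Sum>j\<le>\<mu>. c j * onb \<mu> j z) * (\<Sum>i\<le>\<mu>. onb \<mu> i x * cnj (onb \<mu> i z))))"
    by (simp add: Rstar_def lincomb_onb_def reproducing_kernel_onb mult.assoc)
  also have "\<dots> = lincomb_onb \<mu> (\<lambda>i. \<Sum>j\<le>\<mu>. Rstar_matrix \<mu> f i j * c j) x"
    unfolding integral_mult_sum_onb_sum_cnj_onb[OF assms]
    by (simp add: lincomb_onb_def sum_distrib_right)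
  finally show "Rstar \<mu> f (lincomb_onb \<mu> c) x =
      lincomb_onb \<mu> (\<lambda>i. \<Sum>j\<le>\<mu>. Rstar_matrix \<mu> f i j * c j) x" .
qed

section \<open>The matrix of the transfer operator\<close>

lemma (in pair_sigma_finite)
  fixes g :: "'a \<Rightarrow> complex" and h :: "'b \<Rightarrow> complex"
  assumes g: "integrable M1 g" and h: "integrable M2 h"
  shows integrable_mult_fst_snd: "integrable (M1 \<Otimes>\<^sub>M M2) (\<lambda>p. g (fst p) * h (snd p))"
    and integral_mult_fst_snd: "(LINT p|(M1 \<Otimes>\<^sub>M M2). g (fst p) * h (snd p)) =
        (LINT x|M1. g x) * (LINT y|M2. h y)"
proof -
  have [measurable]: "g \<in> borel_measurable M1" "h \<in> borel_measurable M2"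
    using g h by (auto dest: borel_measurable_integrable)
  show integrable: "integrable (M1 \<Otimes>\<^sub>M M2) (\<lambda>p. g (fst p) * h (snd p))"
  proof (rule Fubini_integrable)
    show "integrable M1 (\<lambda>x. LINT y|M2. cmod (g (fst (x, y)) * h (snd (x, y))))"
      using g by (simp add: norm_mult)
  qed (use h in auto)
  show "(LINT p|(M1 \<Otimes>\<^sub>M M2). g (fst p) * h (snd p)) = (LINT x|M1. g x) * (LINT y|M2. h y)"
    using integral_fst'[OF integrable] by simp
qed

definition lincomb_onb_tensor :: "nat \<Rightarrow> nat \<Rightarrow> (nat \<Rightarrow> nat \<Rightarrow> complex) \<Rightarrow> complex \<Rightarrow> complex \<Rightarrow> complex" where
  "lincomb_onb_tensor \<mu> \<nu> c = (\<lambda>z w. \<Sum>a\<le>\<mu>. \<Sum>b\<le>\<nu>. c a b * (onb \<mu> a z * onb \<nu> b w))"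

lemma onb_mult_onb_eq_lincomb_onb_tensor:
  assumes "a \<le> \<mu>" "b \<le> \<nu>"
  shows "(\<lambda>z w. onb \<mu> a z * onb \<nu> b w) =
      lincomb_onb_tensor \<mu> \<nu> (\<lambda>a' b'. if a' = a \<and> b' = b then 1 else 0)"
proof (intro ext)
  fix z w
  have "(\<Sum>b'\<le>\<nu>. (if a' = a \<and> b' = b then 1 else 0) * (onb \<mu> a' z * onb \<nu> b' w)) =
      (if a' = a then onb \<mu> a z * onb \<nu> b w else 0)" for a'
  proof -
    have "(if a' = a \<and> b' = b then 1 else 0) * (onb \<mu> a' z * onb \<nu> b' w) =
        (if b' = b then if a' = a then onb \<mu> a z * onb \<nu> b w else 0 else 0)" for b'
      by simp
    then show ?thesis using assms by simp
  qed
  then show "onb \<mu> a z * onb \<nu> b w =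
      lincomb_onb_tensor \<mu> \<nu> (\<lambda>a' b'. if a' = a \<and> b' = b then 1 else 0) z w"
    using assms by (simp add: lincomb_onb_tensor_def)
qed

lemma integral_lincomb_onb_tensor:
  "(LINT p|(iota \<mu> \<Otimes>\<^sub>M iota \<nu>). lincomb_onb_tensor \<mu> \<nu> c (fst p) (snd p) *
      (\<Sum>a\<le>\<mu>. \<Sum>b\<le>\<nu>. d a b * cnj (onb \<mu> a (fst p) * onb \<nu> b (snd p)))) = (\<Sum>a\<le>\<mu>. \<Sum>b\<le>\<nu>. c a b * d a b)"
proof -
  interpret pair_sigma_finite "iota \<mu>" "iota \<nu>"
    by (intro pair_sigma_finite.intro sigma_finite_iota)
  define e where "e = (\<lambda>(a, b) p. onb \<mu> a (fst p) * onb \<nu> b (snd p))"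
  define I where "I = {..\<mu>} \<times> {..\<nu>}"
  have e: "e (a, b) p * cnj (e (a', b') p) =
      (onb \<mu> a (fst p) * cnj (onb \<mu> a' (fst p))) *
        (onb \<nu> b (snd p) * cnj (onb \<nu> b' (snd p)))" for a b a' b' p
    by (simp add: e_def)
  have "(LINT p|(iota \<mu> \<Otimes>\<^sub>M iota \<nu>). (\<Sum>i\<in>I. case_prod c i * e i p) *
      (\<Sum>i\<in>I. case_prod d i * cnj (e i p))) =
      (\<Sum>i\<in>I. case_prod c i * case_prod d i)"
  proof (rule integral_orthonormal_sum_mult_sum)
    fix i j assume "i \<in> I" "j \<in> I"
    then obtain a b a' b' where ij: "i = (a, b)" "j = (a', b')" "a \<le> \<mu>" "a' \<le> \<mu>" "b \<le> \<nu>" "b' \<le> \<nu>"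
      by (auto simp: I_def)
    show "integrable (iota \<mu> \<Otimes>\<^sub>M iota \<nu>) (\<lambda>p. e i p * cnj (e j p))"
      unfolding ij(1,2) e using ij by (intro integrable_mult_fst_snd integrable_onb_mult_cnj_onb)
    show "(LINT p|(iota \<mu> \<Otimes>\<^sub>M iota \<nu>). e i p * cnj (e j p)) = (if i = j then 1 else 0)"
      unfolding ij(1,2) e using ij
      by (subst integral_mult_fst_snd)
        (simp_all add: integrable_onb_mult_cnj_onb integral_onb_mult_cnj_onb)
  qed (simp add: I_def)
  then show ?thesis
    by (simp add: lincomb_onb_tensor_def I_def e_def sum.cartesian_product case_prod_unfold)
qed

lemma tensor_id_lincomb_onb_tensor:
  assumes "has_matrix \<mu> A M"
  shows "tensor_id A (lincomb_onb_tensor \<mu> \<nu> c) = lincomb_onb_tensor \<mu> \<nu> (\<lambda>a b. \<Sum>a'\<le>\<mu>. M a a' * c a' b)"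
proof (intro ext)
  fix z w
  have slice: "lincomb_onb_tensor \<mu> \<nu> c' z w = lincomb_onb \<mu> (\<lambda>a. \<Sum>b\<le>\<nu>. c' a b * onb \<nu> b w) z" for c' z
    by (simp add: lincomb_onb_tensor_def lincomb_onb_def sum_distrib_left sum_distrib_right mult_ac)
  have "(\<Sum>a'\<le>\<mu>. M a a' * (\<Sum>b\<le>\<nu>. c a' b * onb \<nu> b w)) =
      (\<Sum>b\<le>\<nu>. (\<Sum>a'\<le>\<mu>. M a a' * c a' b) * onb \<nu> b w)" for a
    unfolding sum_distrib_left sum_distrib_right by (subst sum.swap) (simp only: mult.assoc)
  then show "tensor_id A (lincomb_onb_tensor \<mu> \<nu> c) z w =
      lincomb_onb_tensor \<mu> \<nu> (\<lambda>a b. \<Sum>a'\<le>\<mu>. M a a' * c a' b) z w"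
    using assms by (simp add: tensor_id_def slice has_matrix_def)
qed

text \<open>The \<open>l\<close>-th term of a Krawtchouk polynomial, up to the sign \<open>(-1)\<^sup>k\<close>.\<close>

definition krawtchouk_term :: "nat \<Rightarrow> nat \<Rightarrow> nat \<Rightarrow> nat \<Rightarrow> real" where
  "krawtchouk_term m k a l =
    (if l \<le> a then (-1) ^ (k - l) * real (k choose l) * real (m choose (a - l)) else 0)"

lemma power_mult_power_eq_sum_krawtchouk:
  fixes s w y :: complex
  shows "(1 + y * s) ^ m * (s - w) ^ k =
    (\<Sum>a\<le>m + k. (\<Sum>l\<le>k. of_real (krawtchouk_term m k a l) * (w ^ (k - l) * y ^ (a - l))) * s ^ a)"
proof -
  have "(s - w) ^ k = (\<Sum>l\<le>k. of_nat (k choose l) * s ^ l * (- w) ^ (k - l))"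
    using binomial_ring[of s "- w" k] by simp
  then have "(1 + y * s) ^ m * (s - w) ^ k =
      (\<Sum>l\<le>k. of_nat (k choose l) * (- w) ^ (k - l) * (s ^ l * (1 + y * s) ^ m))"
    by (simp add: sum_distrib_left mult_ac)
  also have "\<dots> =
      (\<Sum>l\<le>k. \<Sum>a\<le>m + k. of_real (krawtchouk_term m k a l) * (w ^ (k - l) * y ^ (a - l)) * s ^ a)"
  proof (rule sum.cong[OF refl])
    fix l assume "l \<in> {..k}"
    then have "s ^ l * (1 + y * s) ^ m =
        (\<Sum>a\<le>m + k. (if l \<le> a then of_nat (m choose (a - l)) * y ^ (a - l) else 0) * s ^ a)"
      by (intro power_mult_one_plus_power) simp
    then show "of_nat (k choose l) * (- w) ^ (k - l) * (s ^ l * (1 + y * s) ^ m) =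
        (\<Sum>a\<le>m + k. of_real (krawtchouk_term m k a l) * (w ^ (k - l) * y ^ (a - l)) * s ^ a)"
      by (simp only: sum_distrib_left power_minus[of w])
        (intro sum.cong refl, simp add: krawtchouk_term_def)
  qed
  also have "\<dots> =
      (\<Sum>a\<le>m + k. (\<Sum>l\<le>k. of_real (krawtchouk_term m k a l) * (w ^ (k - l) * y ^ (a - l))) * s ^ a)"
    by (subst sum.swap) (simp only: sum_distrib_right)
  finally show ?thesis .
qed

definition Jk_coeff :: "nat \<Rightarrow> nat \<Rightarrow> nat \<Rightarrow> nat \<Rightarrow> nat \<Rightarrow> real" where
  "Jk_coeff \<mu> \<nu> k a b = (\<Sum>l\<le>k. krawtchouk_term (\<mu> - k) k a l *
     (if k - l \<le> b then real (\<nu> - k choose (b - (k - l))) else 0))"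

lemma Jk_coeff_eq_0:
  assumes "k \<le> \<mu>" "k \<le> \<nu>" "\<not> (k \<le> a + b \<and> a + b \<le> \<mu> + \<nu> - k)"
  shows "Jk_coeff \<mu> \<nu> k a b = 0"
  unfolding Jk_coeff_def using assms by (intro sum.neutral) (auto simp: krawtchouk_term_def)

lemma Jk_kernel_eq_sum:
  fixes z w \<xi> :: complex
  assumes "k \<le> \<mu>" "k \<le> \<nu>"
  shows "(z - w) ^ k * (1 + \<xi> * z) ^ (\<mu> - k) * (1 + \<xi> * w) ^ (\<nu> - k) =
    (\<Sum>a\<le>\<mu>. \<Sum>b\<le>\<nu>. of_real (Jk_coeff \<mu> \<nu> k a b) * \<xi> ^ (a + b - k) * (z ^ a * w ^ b))"
proof -
  define K where "K = (\<lambda>a l. complex_of_real (krawtchouk_term (\<mu> - k) k a l))"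
  define B where "B = (\<lambda>l b. if k - l \<le> b then of_nat (\<nu> - k choose (b - (k - l))) else (0 :: complex))"
  have coeff: "(\<Sum>l\<le>k. K a l * B l b) = of_real (Jk_coeff \<mu> \<nu> k a b)" for a b
    by (auto simp: Jk_coeff_def K_def B_def intro: sum.cong)
  have w: "w ^ (k - l) * (1 + \<xi> * w) ^ (\<nu> - k) = (\<Sum>b\<le>\<nu>. B l b * \<xi> ^ (b - (k - l)) * w ^ b)" for l
    using power_mult_one_plus_power[of "k - l" "\<nu> - k" \<nu> w \<xi>] assms(2)
    by (simp add: B_def if_distrib[where f = "\<lambda>x. x * _"] cong: if_cong)
  have \<xi>: "K a l * \<xi> ^ (a - l) * (B l b * \<xi> ^ (b - (k - l))) = K a l * B l b * \<xi> ^ (a + b - k)"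
      if "l \<le> k" for a b l
  proof (cases "l \<le> a \<and> k - l \<le> b")
    case True
    then have "a + b - k = a - l + (b - (k - l))" using that by linarith
    then show ?thesis by (simp only: power_add mult_ac)
  qed (auto simp: K_def B_def krawtchouk_term_def)
  have "(z - w) ^ k * (1 + \<xi> * z) ^ (\<mu> - k) * (1 + \<xi> * w) ^ (\<nu> - k) =
      (\<Sum>a\<le>\<mu>. \<Sum>l\<le>k. K a l * \<xi> ^ (a - l) * z ^ a * (w ^ (k - l) * (1 + \<xi> * w) ^ (\<nu> - k)))"
    using power_mult_power_eq_sum_krawtchouk[of \<xi> z "\<mu> - k" w k] assms(1)
    by (simp add: K_def sum_distrib_left sum_distrib_right mult_ac)
  also have "\<dots> =
      (\<Sum>a\<le>\<mu>. \<Sum>l\<le>k. \<Sum>b\<le>\<nu>. K a l * \<xi> ^ (a - l) * (B l b * \<xi> ^ (b - (k - l))) * (z ^ a * w ^ b))"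
    unfolding w by (simp add: sum_distrib_left mult_ac)
  also have "\<dots> = (\<Sum>a\<le>\<mu>. \<Sum>l\<le>k. \<Sum>b\<le>\<nu>. K a l * B l b * \<xi> ^ (a + b - k) * (z ^ a * w ^ b))"
    by (intro sum.cong refl) (simp only: \<xi> atMost_iff)
  also have "\<dots> = (\<Sum>a\<le>\<mu>. \<Sum>b\<le>\<nu>. (\<Sum>l\<le>k. K a l * B l b) * \<xi> ^ (a + b - k) * (z ^ a * w ^ b))"
    unfolding sum_distrib_right by (rule sum.cong[OF refl], rule sum.swap)
  finally show ?thesis unfolding coeff .
qed

definition clebsch_gordan :: "nat \<Rightarrow> nat \<Rightarrow> nat \<Rightarrow> nat \<Rightarrow> nat \<Rightarrow> nat \<Rightarrow> real" where
  "clebsch_gordan \<mu> \<nu> k a b i = (if a + b = i + k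
     then Cmnk \<mu> \<nu> k * Jk_coeff \<mu> \<nu> k a b /
       (sqrt (real (\<mu> choose a)) * sqrt (real (\<nu> choose b)) * sqrt (real (\<mu> + \<nu> - 2 * k choose i)))
     else 0)"

lemma lincomb_onb_clebsch_gordan:
  assumes k: "k \<le> \<mu>" "k \<le> \<nu>"
  shows "lincomb_onb (\<mu> + \<nu> - 2 * k) (\<lambda>i. of_real (clebsch_gordan \<mu> \<nu> k a b i)) \<xi> =
    of_real (Cmnk \<mu> \<nu> k * Jk_coeff \<mu> \<nu> k a b /
      (sqrt (real (\<mu> choose a)) * sqrt (real (\<nu> choose b)))) * \<xi> ^ (a + b - k)"
proof (cases "k \<le> a + b \<and> a + b \<le> \<mu> + \<nu> - k")
  case True
  define N i where "N = \<mu> + \<nu> - 2 * k" and "i = a + b - k"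
  have i: "i \<le> N" "a + b = i' + k \<longleftrightarrow> i' = i" for i' using True k by (auto simp: N_def i_def)
  have "lincomb_onb N (\<lambda>i. of_real (clebsch_gordan \<mu> \<nu> k a b i)) \<xi> =
      (\<Sum>i'\<le>N. if i' = i then of_real (clebsch_gordan \<mu> \<nu> k a b i) * onb N i \<xi> else 0)"
    unfolding lincomb_onb_def by (intro sum.cong refl) (auto simp: clebsch_gordan_def i)
  also have "\<dots> = of_real (clebsch_gordan \<mu> \<nu> k a b i * sqrt (real (N choose i))) * \<xi> ^ i"
    using i(1) by (simp add: onb_def)
  also have "clebsch_gordan \<mu> \<nu> k a b i * sqrt (real (N choose i)) =
      Cmnk \<mu> \<nu> k * Jk_coeff \<mu> \<nu> k a b / (sqrt (real (\<mu> choose a)) * sqrt (real (\<nu> choose b)))"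
    using i by (simp add: clebsch_gordan_def N_def)
  finally show ?thesis unfolding N_def i_def .
next
  case False
  then have "clebsch_gordan \<mu> \<nu> k a b i = 0" for i
    using Jk_coeff_eq_0[OF k False] by (simp add: clebsch_gordan_def)
  then show ?thesis using Jk_coeff_eq_0[OF k False] by (simp add: lincomb_onb_def)
qed

lemma Jk_kernel_eq_sum_onb:
  assumes k: "k \<le> \<mu>" "k \<le> \<nu>"
  shows "of_real (Cmnk \<mu> \<nu> k) *
      ((cnj z - cnj w) ^ k * (1 + \<xi> * cnj z) ^ (\<mu> - k) * (1 + \<xi> * cnj w) ^ (\<nu> - k)) =
    (\<Sum>a\<le>\<mu>. \<Sum>b\<le>\<nu>. lincomb_onb (\<mu> + \<nu> - 2 * k) (\<lambda>i. of_real (clebsch_gordan \<mu> \<nu> k a b i)) \<xi> *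
      cnj (onb \<mu> a z * onb \<nu> b w))"
  unfolding Jk_kernel_eq_sum[OF k] lincomb_onb_clebsch_gordan[OF k] sum_distrib_left
  by (intro sum.cong refl) (simp add: onb_def)

lemma Pk_lincomb_onb_tensor:
  assumes "k \<le> \<mu>" "k \<le> \<nu>"
  shows "Pk \<mu> \<nu> k (lincomb_onb_tensor \<mu> \<nu> c) =
    lincomb_onb (\<mu> + \<nu> - 2 * k) (\<lambda>i. \<Sum>a\<le>\<mu>. \<Sum>b\<le>\<nu>. of_real (clebsch_gordan \<mu> \<nu> k a b i) * c a b)"
proof
  fix \<xi>
  define L where "L = (\<lambda>a b. lincomb_onb (\<mu> + \<nu> - 2 * k) (\<lambda>i. of_real (clebsch_gordan \<mu> \<nu> k a b i)) \<xi>)"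
  have "Pk \<mu> \<nu> k (lincomb_onb_tensor \<mu> \<nu> c) \<xi> = (LINT p|(iota \<mu> \<Otimes>\<^sub>M iota \<nu>).
      lincomb_onb_tensor \<mu> \<nu> c (fst p) (snd p) * (of_real (Cmnk \<mu> \<nu> k) *
        ((cnj (fst p) - cnj (snd p)) ^ k *
          (1 + \<xi> * cnj (fst p)) ^ (\<mu> - k) * (1 + \<xi> * cnj (snd p)) ^ (\<nu> - k))))"
    by (simp add: Pk_def Jk_def mult_ac flip: integral_mult_right_zero)
  also have "\<dots> = (\<Sum>a\<le>\<mu>. \<Sum>b\<le>\<nu>. c a b * L a b)"
    unfolding Jk_kernel_eq_sum_onb[OF assms] L_def by (rule integral_lincomb_onb_tensor)
  also have "\<dots> = (\<Sum>i\<le>\<mu> + \<nu> - 2 * k. \<Sum>a\<le>\<mu>. \<Sum>b\<le>\<nu>.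
      of_real (clebsch_gordan \<mu> \<nu> k a b i) * c a b * onb (\<mu> + \<nu> - 2 * k) i \<xi>)"
    unfolding L_def lincomb_onb_def sum_distrib_left
    by (subst (2) sum.swap, subst sum.swap) (simp only: mult_ac)
  finally show "Pk \<mu> \<nu> k (lincomb_onb_tensor \<mu> \<nu> c) \<xi> =
      lincomb_onb (\<mu> + \<nu> - 2 * k) (\<lambda>i. \<Sum>a\<le>\<mu>. \<Sum>b\<le>\<nu>. of_real (clebsch_gordan \<mu> \<nu> k a b i) * c a b) \<xi>"
    by (simp add: lincomb_onb_def sum_distrib_right)
qed

lemma Pk_onb_mult_onb:
  assumes "k \<le> \<mu>" "k \<le> \<nu>" "a \<le> \<mu>" "b \<le> \<nu>"
  shows "Pk \<mu> \<nu> k (\<lambda>z w. onb \<mu> a z * onb \<nu> b w) =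
    lincomb_onb (\<mu> + \<nu> - 2 * k) (\<lambda>i. of_real (clebsch_gordan \<mu> \<nu> k a b i))"
proof -
  have "(\<Sum>a'\<le>\<mu>. \<Sum>b'\<le>\<nu>. of_real (clebsch_gordan \<mu> \<nu> k a' b' i) * (if a' = a \<and> b' = b then 1 else 0)) =
      complex_of_real (clebsch_gordan \<mu> \<nu> k a b i)" for i
  proof -
    have "complex_of_real (clebsch_gordan \<mu> \<nu> k a' b' i) * (if a' = a \<and> b' = b then 1 else 0) =
        (if b' = b then if a' = a then of_real (clebsch_gordan \<mu> \<nu> k a b i) else 0 else 0)" for a' b'
      by simp
    then show ?thesis using assms by simp
  qed
  then show ?thesis
    by (simp add: onb_mult_onb_eq_lincomb_onb_tensor assms Pk_lincomb_onb_tensor)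
qed

lemma Pk_adj_lincomb_onb:
  assumes "k \<le> \<mu>" "k \<le> \<nu>"
  shows "Pk_adj \<mu> \<nu> k (lincomb_onb (\<mu> + \<nu> - 2 * k) c) =
    lincomb_onb_tensor \<mu> \<nu> (\<lambda>a b. \<Sum>i\<le>\<mu> + \<nu> - 2 * k. of_real (clebsch_gordan \<mu> \<nu> k a b i) * c i)"
  unfolding Pk_adj_def lincomb_onb_tensor_def
  by (intro ext sum.cong refl) (simp add: Pk_onb_mult_onb assms inner_H_lincomb_onb mult_ac)

definition transfer_matrix :: "nat \<Rightarrow> nat \<Rightarrow> nat \<Rightarrow> (nat \<Rightarrow> nat \<Rightarrow> complex) \<Rightarrow> nat \<Rightarrow> nat \<Rightarrow> complex" where
  "transfer_matrix \<mu> \<nu> k M i j = (\<Sum>a\<le>\<mu>. \<Sum>a'\<le>\<mu>. M a a' *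
     (\<Sum>b\<le>\<nu>. of_real (clebsch_gordan \<mu> \<nu> k a b i * clebsch_gordan \<mu> \<nu> k a' b j)))"

lemma has_matrix_Tmap:
  assumes k: "k \<le> \<mu>" "k \<le> \<nu>" and A: "has_matrix \<mu> A M"
  shows "has_matrix (\<mu> + \<nu> - 2 * k) (Tmap \<mu> \<nu> k A) (transfer_matrix \<mu> \<nu> k M)"
  unfolding has_matrix_def
proof
  fix c
  define N where "N = \<mu> + \<nu> - 2 * k"
  define g where "g = (\<lambda>a b i. complex_of_real (clebsch_gordan \<mu> \<nu> k a b i))"
  have "(\<Sum>j\<le>N. transfer_matrix \<mu> \<nu> k M i j * c j) =
      (\<Sum>j\<le>N. \<Sum>a\<le>\<mu>. \<Sum>a'\<le>\<mu>. \<Sum>b\<le>\<nu>. g a b i * (M a a' * (g a' b j * c j)))" for i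
    by (simp add: transfer_matrix_def g_def sum_distrib_left sum_distrib_right mult_ac)
  also have "\<dots> i = (\<Sum>a\<le>\<mu>. \<Sum>b\<le>\<nu>. \<Sum>a'\<le>\<mu>. \<Sum>j\<le>N. g a b i * (M a a' * (g a' b j * c j)))" for i
    by (subst sum.swap, rule sum.cong[OF refl],
        subst (3) sum.swap, subst sum.swap, subst (2) sum.swap) (rule refl)
  finally show "Tmap \<mu> \<nu> k A (lincomb_onb (\<mu> + \<nu> - 2 * k) c) =
      lincomb_onb (\<mu> + \<nu> - 2 * k) (\<lambda>i. \<Sum>j\<le>\<mu> + \<nu> - 2 * k. transfer_matrix \<mu> \<nu> k M i j * c j)"
    by (simp add: Tmap_def Pk_adj_lincomb_onb[OF k] tensor_id_lincomb_onb_tensor[OF A]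
        Pk_lincomb_onb_tensor[OF k]
        sum_distrib_left N_def g_def)
qed

section \<open>Locally Toeplitz matrices\<close>

lemma tendsto_ratio_of_bounded_diff:
  fixes i j :: "nat \<Rightarrow> nat"
  assumes i: "(\<lambda>\<nu>. real (i \<nu>) / real \<nu>) \<longlonglongrightarrow> x" and diff: "\<And>\<nu>. i \<nu> \<le> j \<nu> + c" "\<And>\<nu>. j \<nu> \<le> i \<nu> + c"
  shows "(\<lambda>\<nu>. real (j \<nu>) / real \<nu>) \<longlonglongrightarrow> x"
proof -
  have "(\<lambda>\<nu>. real (j \<nu>) / real \<nu> - real (i \<nu>) / real \<nu>) \<longlonglongrightarrow> 0"
  proof (rule Lim_null_comparison)
    have "\<bar>real (j \<nu>) - real (i \<nu>)\<bar> \<le> real c" for \<nu> using diff[of \<nu>] by linarith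
    then have "norm (real (j \<nu>) / real \<nu> - real (i \<nu>) / real \<nu>) \<le> real c / real \<nu>" for \<nu>
      by (simp add: divide_right_mono flip: diff_divide_distrib)
    then show "\<forall>\<^sub>F \<nu> in sequentially. norm (real (j \<nu>) / real \<nu> - real (i \<nu>) / real \<nu>) \<le>
        real c / real \<nu>"
      by (rule always_eventually[OF allI])
    show "(\<lambda>\<nu>. real c / real \<nu>) \<longlonglongrightarrow> 0" by real_asymp
  qed
  from tendsto_add[OF i this] show ?thesis by simp
qed

lemma eventually_add_le_of_tendsto_ratio:
  fixes i j :: "nat \<Rightarrow> nat"
  assumes i: "(\<lambda>\<nu>. real (i \<nu>) / real \<nu>) \<longlonglongrightarrow> x" and j: "(\<lambda>\<nu>. real (j \<nu>) / real \<nu>) \<longlonglongrightarrow> y" and "x < y"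
  shows "\<forall>\<^sub>F \<nu> in sequentially. i \<nu> + c \<le> j \<nu>"
proof -
  have "(\<lambda>\<nu>. real (i \<nu> + c) / real \<nu>) \<longlonglongrightarrow> x"
    by (rule tendsto_ratio_of_bounded_diff[OF i, of _ c]) simp_all
  from tendsto_diff[OF j this]
  have "\<forall>\<^sub>F \<nu> in sequentially. 0 < real (j \<nu>) / real \<nu> - real (i \<nu> + c) / real \<nu>"
    using \<open>x < y\<close> by (intro order_tendstoD) auto
  then show ?thesis
    by eventually_elim (simp add: zero_less_divide_iff flip: diff_divide_distrib)
qed

lemma eventually_le_of_tendsto_ratio:
  fixes j :: "nat \<Rightarrow> nat"
  assumes "(\<lambda>\<nu>. real (j \<nu>) / real \<nu>) \<longlonglongrightarrow> x" "0 < x"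
  shows "\<forall>\<^sub>F \<nu> in sequentially. c \<le> j \<nu>"
  using eventually_add_le_of_tendsto_ratio[of "\<lambda>_. 0" 0 j x c] assms by simp

definition banded :: "nat \<Rightarrow> (nat \<Rightarrow> nat \<Rightarrow> 'a::zero) \<Rightarrow> bool" where
  "banded w M \<longleftrightarrow> (\<forall>i j. M i j \<noteq> 0 \<longrightarrow> i \<le> j + w \<and> j \<le> i + w)"

lemma bandedD:
  assumes "banded w M" "M i j \<noteq> 0"
  shows "i \<le> j + w" "j \<le> i + w"
  using assms by (simp_all add: banded_def)

lemma banded_mat_mult:
  assumes A: "banded v A" and B: "banded w B"
  shows "banded (v + w) (mat_mult N A B)"
  unfolding banded_def
proof (intro allI impI)
  fix i j assume "mat_mult N A B i j \<noteq> 0"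
  then obtain l where "A i l * B l j \<noteq> 0"
    unfolding mat_mult_def by (rule sum.not_neutral_contains_not_neutral)
  then have "A i l \<noteq> 0" "B l j \<noteq> 0" by auto
  then show "i \<le> j + (v + w) \<and> j \<le> i + (v + w)"
    using bandedD[OF A, of i l] bandedD[OF B, of l j] by linarith
qed

lemma norm_mat_mult_banded_le:
  fixes A B :: "nat \<Rightarrow> nat \<Rightarrow> 'a::real_normed_algebra_1"
  assumes B: "banded w B" and K: "\<And>i j. norm (A i j) \<le> K" and L: "\<And>i j. norm (B i j) \<le> L"
  shows "norm (mat_mult N A B i j) \<le> real (2 * w + 1) * (K * L)"
proof -
  define I where "I = {..N} \<inter> {j - w..j + w}"
  have nonneg: "0 \<le> K" "0 \<le> L"
    using order_trans[OF norm_ge_zero K] order_trans[OF norm_ge_zero L] by simp_all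
  have "mat_mult N A B i j = (\<Sum>l\<in>I. A i l * B l j)"
    unfolding mat_mult_def
  proof (rule sum.mono_neutral_right)
    have "l \<in> {j - w..j + w}" if "B l j \<noteq> 0" for l using bandedD[OF B that] by auto
    then show "\<forall>l\<in>{..N} - I. A i l * B l j = 0"
      unfolding I_def by (metis DiffD1 DiffD2 IntI mult_zero_right)
  qed (auto simp: I_def)
  also have "norm \<dots> \<le> real (card I) * (K * L)"
    using nonneg K L by (intro sum_norm_bound order_trans[OF norm_mult_ineq] mult_mono) auto
  also have "\<dots> \<le> real (2 * w + 1) * (K * L)"
  proof -
    have "card I \<le> card {j - w..j + w}" unfolding I_def by (intro card_mono) auto
    then have "real (card I) \<le> real (2 * w + 1)" by simp
    then show ?thesis using nonneg by (intro mult_right_mono) auto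
  qed
  finally show ?thesis .
qed

lemma mat_mult_banded_eq_sum:
  assumes A: "banded v A" and B: "banded w B" and j: "v + w \<le> j" "j + m \<le> N"
  shows "mat_mult N A B (j + m - (v + w)) j = (\<Sum>e\<le>m. A (j + m - (v + w)) (j + e - w) * B (j + e - w) j)"
proof -
  define i where "i = j + m - (v + w)"
  have "mat_mult N A B i j = (\<Sum>l\<in>{j - w..j + m - w}. A i l * B l j)"
    unfolding mat_mult_def
  proof (rule sum.mono_neutral_right)
    have "l \<in> {j - w..j + m - w}" if "A i l \<noteq> 0" "B l j \<noteq> 0" for l
      using bandedD[OF A that(1)] bandedD[OF B that(2)] j(1) by (auto simp: i_def)
    then show "\<forall>l\<in>{..N} - {j - w..j + m - w}. A i l * B l j = 0"
      by (metis DiffD2 mult_zero_left mult_zero_right)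
  qed (use j in auto)
  also have "\<dots> = (\<Sum>e\<le>m. A i (j + e - w) * B (j + e - w) j)"
    by (rule sum.reindex_bij_witness[where i = "\<lambda>e. j + e - w" and j = "\<lambda>l. l - (j - w)"])
      (use j(1) in auto)
  finally show ?thesis by (simp only: i_def)
qed

text \<open>
  The limit of the entries on the diagonal \<open>i - j = m - w\<close> is the \<open>m\<close>-th coefficient of \<open>\<sigma> x\<close>: the
  symbol is the Laurent polynomial \<open>u\<^sup>-\<^sup>w * \<sigma> x\<close>.
\<close>

definition locally_toeplitz :: "nat \<Rightarrow> (nat \<Rightarrow> nat \<Rightarrow> nat \<Rightarrow> complex) \<Rightarrow> (real \<Rightarrow> complex poly) \<Rightarrow> bool" where
  "locally_toeplitz w M \<sigma> \<longleftrightarrow>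
    (\<forall>\<nu>. banded w (M \<nu>)) \<and>
    (\<exists>K. \<forall>\<^sub>F \<nu> in sequentially. \<forall>i j. cmod (M \<nu> i j) \<le> K) \<and>
    (\<forall>x j m. 0 < x \<longrightarrow> x < 1 \<longrightarrow> (\<lambda>\<nu>. real (j \<nu>) / real \<nu>) \<longlonglongrightarrow> x \<longrightarrow>
      (\<lambda>\<nu>. M \<nu> (j \<nu> + m - w) (j \<nu>)) \<longlonglongrightarrow> coeff (\<sigma> x) m)"

lemma locally_toeplitzI:
  assumes "\<And>\<nu>. banded w (M \<nu>)"
    and "\<forall>\<^sub>F \<nu> in sequentially. \<forall>i j. cmod (M \<nu> i j) \<le> K"
    and "\<And>x j m. 0 < x \<Longrightarrow> x < 1 \<Longrightarrow> (\<lambda>\<nu>. real (j \<nu>) / real \<nu>) \<longlonglongrightarrow> x \<Longrightarrow>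
      (\<lambda>\<nu>. M \<nu> (j \<nu> + m - w) (j \<nu>)) \<longlonglongrightarrow> coeff (\<sigma> x) m"
  shows "locally_toeplitz w M \<sigma>"
  unfolding locally_toeplitz_def
proof (intro conjI allI impI)
  show "\<exists>K. \<forall>\<^sub>F \<nu> in sequentially. \<forall>i j. cmod (M \<nu> i j) \<le> K" using assms(2) ..
qed (use assms(1,3) in simp_all)

lemma locally_toeplitz_banded: "locally_toeplitz w M \<sigma> \<Longrightarrow> banded w (M \<nu>)"
  by (simp add: locally_toeplitz_def)

lemma locally_toeplitz_bounded:
  assumes "locally_toeplitz w M \<sigma>"
  obtains K where "\<forall>\<^sub>F \<nu> in sequentially. \<forall>i j. cmod (M \<nu> i j) \<le> K"
  using assms unfolding locally_toeplitz_def by (elim conjE exE)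

lemma locally_toeplitz_tendsto:
  assumes "locally_toeplitz w M \<sigma>" "0 < x" "x < 1" "(\<lambda>\<nu>. real (j \<nu>) / real \<nu>) \<longlonglongrightarrow> x"
  shows "(\<lambda>\<nu>. M \<nu> (j \<nu> + m - w) (j \<nu>)) \<longlonglongrightarrow> coeff (\<sigma> x) m"
  using assms unfolding locally_toeplitz_def by simp

lemma locally_toeplitz_tendsto_shifted:
  fixes j :: "nat \<Rightarrow> nat"
  assumes M: "locally_toeplitz v M \<sigma>" and x: "0 < x" "x < 1"
    and j: "(\<lambda>\<nu>. real (j \<nu>) / real \<nu>) \<longlonglongrightarrow> x" and "e \<le> m"
  shows "(\<lambda>\<nu>. M \<nu> (j \<nu> + m - (v + w)) (j \<nu> + e - w)) \<longlonglongrightarrow> coeff (\<sigma> x) (m - e)"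
proof -
  have "(\<lambda>\<nu>. real (j \<nu> + e - w) / real \<nu>) \<longlonglongrightarrow> x"
    by (rule tendsto_ratio_of_bounded_diff[OF j, of _ "e + w"]) auto
  from locally_toeplitz_tendsto[OF M x this]
  have "(\<lambda>\<nu>. M \<nu> (j \<nu> + e - w + (m - e) - v) (j \<nu> + e - w)) \<longlonglongrightarrow> coeff (\<sigma> x) (m - e)" .
  moreover have "\<forall>\<^sub>F \<nu> in sequentially.
      M \<nu> (j \<nu> + e - w + (m - e) - v) (j \<nu> + e - w) = M \<nu> (j \<nu> + m - (v + w)) (j \<nu> + e - w)"
    using eventually_le_of_tendsto_ratio[OF j x(1), of w]
  proof eventually_elim
    case (elim \<nu>)
    then have "j \<nu> + e - w + (m - e) - v = j \<nu> + m - (v + w)" using \<open>e \<le> m\<close> by linarith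
    then show ?case by simp
  qed
  ultimately show ?thesis by (rule Lim_transform_eventually)
qed

lemma locally_toeplitz_mult:
  assumes A: "locally_toeplitz v A \<sigma>" and B: "locally_toeplitz w B \<tau>"
    and N: "(\<lambda>\<nu>. real (N \<nu>) / real \<nu>) \<longlonglongrightarrow> 1"
  shows "locally_toeplitz (v + w) (\<lambda>\<nu>. mat_mult (N \<nu>) (A \<nu>) (B \<nu>)) (\<lambda>x. \<sigma> x * \<tau> x)"
proof -
  note banded = locally_toeplitz_banded[OF A] locally_toeplitz_banded[OF B]
  obtain K where K: "\<forall>\<^sub>F \<nu> in sequentially. \<forall>i j. cmod (A \<nu> i j) \<le> K"
    using locally_toeplitz_bounded[OF A] .
  obtain L where L: "\<forall>\<^sub>F \<nu> in sequentially. \<forall>i j. cmod (B \<nu> i j) \<le> L"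
    using locally_toeplitz_bounded[OF B] .
  show ?thesis
  proof (rule locally_toeplitzI)
    show "banded (v + w) (mat_mult (N \<nu>) (A \<nu>) (B \<nu>))" for \<nu>
      by (rule banded_mat_mult[OF banded])
    show "\<forall>\<^sub>F \<nu> in sequentially. \<forall>i j. cmod (mat_mult (N \<nu>) (A \<nu>) (B \<nu>) i j) \<le>
        real (2 * w + 1) * (K * L)"
      using K L by eventually_elim (intro allI norm_mat_mult_banded_le banded; simp)
  next
    fix x j m assume x: "0 < x" "x < 1" and j: "(\<lambda>\<nu>. real (j \<nu>) / real \<nu>) \<longlonglongrightarrow> x"
    define row where "row = (\<lambda>\<nu>. j \<nu> + m - (v + w))"
    define col where "col = (\<lambda>e \<nu>. j \<nu> + e - w)"
    have "(\<lambda>\<nu>. \<Sum>e\<le>m. A \<nu> (row \<nu>) (col e \<nu>) * B \<nu> (col e \<nu>) (j \<nu>)) \<longlonglongrightarrow>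
        (\<Sum>e\<le>m. coeff (\<sigma> x) (m - e) * coeff (\<tau> x) e)"
      unfolding row_def col_def
      by (intro tendsto_sum tendsto_mult locally_toeplitz_tendsto[OF B x j]
          locally_toeplitz_tendsto_shifted[OF A x j]) simp
    also have "(\<Sum>e\<le>m. coeff (\<sigma> x) (m - e) * coeff (\<tau> x) e) = coeff (\<sigma> x * \<tau> x) m"
      unfolding mult.commute[of "\<sigma> x"] coeff_mult by (simp only: mult.commute)
    finally have "(\<lambda>\<nu>. \<Sum>e\<le>m. A \<nu> (row \<nu>) (col e \<nu>) * B \<nu> (col e \<nu>) (j \<nu>)) \<longlonglongrightarrow> coeff (\<sigma> x * \<tau> x) m" .
    moreover have "\<forall>\<^sub>F \<nu> in sequentially. (\<Sum>e\<le>m. A \<nu> (row \<nu>) (col e \<nu>) * B \<nu> (col e \<nu>) (j \<nu>)) =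
        mat_mult (N \<nu>) (A \<nu>) (B \<nu>) (j \<nu> + m - (v + w)) (j \<nu>)"
      using eventually_le_of_tendsto_ratio[OF j x(1), of "v + w"]
        eventually_add_le_of_tendsto_ratio[OF j N x(2), of m]
      by eventually_elim (simp only: mat_mult_banded_eq_sum[OF banded] row_def col_def)
    ultimately show "(\<lambda>\<nu>. mat_mult (N \<nu>) (A \<nu>) (B \<nu>) (j \<nu> + m - (v + w)) (j \<nu>)) \<longlonglongrightarrow> coeff (\<sigma> x * \<tau> x) m"
      by (rule Lim_transform_eventually)
  qed
qed

lemma locally_toeplitz_power:
  assumes M: "locally_toeplitz w M \<sigma>" and N: "(\<lambda>\<nu>. real (N \<nu>) / real \<nu>) \<longlonglongrightarrow> 1"
  shows "locally_toeplitz (n * w) (\<lambda>\<nu>. mat_power (N \<nu>) (M \<nu>) n) (\<lambda>x. \<sigma> x ^ n)"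
proof (induction n)
  case 0
  show ?case
    by (rule locally_toeplitzI[where K = 1]) (simp_all add: banded_def)
next
  case (Suc n)
  from locally_toeplitz_mult[OF M this N] show ?case by simp
qed

lemma step_function_has_integral:
  fixes h :: "nat \<Rightarrow> 'a::banach"
  assumes n: "0 < n"
  shows "((\<lambda>x. h (nat \<lfloor>real n * x\<rfloor>)) has_integral (\<Sum>j<m. h j) /\<^sub>R real n) {0..real m / real n}"
proof (induction m)
  case 0
  show ?case using has_integral_refl(2)[of _ "0::real"] by simp
next
  case (Suc m)
  define l u where "l = real m / real n" and "u = real (Suc m) / real n"
  have lu: "0 \<le> l" "l \<le> u" "u - l = inverse (real n)"
    using n by (simp_all add: l_def u_def inverse_eq_divide divide_right_mono flip: diff_divide_distrib)
  have const_integral: "((\<lambda>x. h m) has_integral (u - l) *\<^sub>R h m) {l..u}"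
    using has_integral_const_real[of "h m" l u] lu by simp
  have step: "h (nat \<lfloor>real n * x\<rfloor>) = h m" if "x \<in> {l..u} - {u}" for x
  proof -
    have "real m \<le> real n * x" "real n * x < real m + 1"
      using that n by (auto simp: l_def u_def field_simps)
    then have "\<lfloor>real n * x\<rfloor> = int m" by (simp add: floor_unique)
    then show ?thesis by simp
  qed
  have "((\<lambda>x. h (nat \<lfloor>real n * x\<rfloor>)) has_integral (u - l) *\<^sub>R h m) {l..u}"
    by (rule has_integral_spike_finite[where S = "{u}" and f = "\<lambda>x. h m"])
      (use step const_integral in \<open>blast+\<close>)
  from has_integral_combine[OF lu(1,2) Suc.IH[folded l_def] this]
  show ?case unfolding u_def[symmetric] by (simp add: lu scaleR_add_right)
qed

lemma mean_tendsto_integral: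
  fixes h :: "nat \<Rightarrow> nat \<Rightarrow> 'a::euclidean_space"
  assumes n: "\<And>\<nu>. 0 < n \<nu>"
    and bound: "\<forall>\<^sub>F \<nu> in sequentially. \<forall>j. norm (h \<nu> j) \<le> K"
    and lim: "\<And>x. 0 < x \<Longrightarrow> x < 1 \<Longrightarrow> (\<lambda>\<nu>. h \<nu> (nat \<lfloor>real (n \<nu>) * x\<rfloor>)) \<longlonglongrightarrow> \<phi> x"
  shows "(\<lambda>\<nu>. (\<Sum>j<n \<nu>. h \<nu> j) /\<^sub>R real (n \<nu>)) \<longlonglongrightarrow> integral {0..1} \<phi>"
proof -
  obtain \<nu>\<^sub>0 where bound: "\<And>\<nu> j. \<nu>\<^sub>0 \<le> \<nu> \<Longrightarrow> norm (h \<nu> j) \<le> K"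
    using bound by (auto simp: eventually_sequentially)
  define step where "step = (\<lambda>\<nu> x. h \<nu> (nat \<lfloor>real (n \<nu>) * x\<rfloor>))"
  have step: "(step \<nu> has_integral (\<Sum>j<n \<nu>. h \<nu> j) /\<^sub>R real (n \<nu>)) {0<..<1}" for \<nu>
    using step_function_has_integral[OF n, of "h \<nu>" \<nu> "n \<nu>"] n[of \<nu>]
    by (simp add: step_def has_integral_Icc_iff_Ioo)
  have "(\<lambda>\<nu>. integral {0<..<1} (step (\<nu> + \<nu>\<^sub>0))) \<longlonglongrightarrow> integral {0<..<1} \<phi>"
  proof (rule dominated_convergence(2))
    show "step (\<nu> + \<nu>\<^sub>0) integrable_on {0<..<1}" for \<nu>
      using step by (rule has_integral_integrable)
    show "(\<lambda>x. K) integrable_on {0<..<1::real}"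
      by (simp add: integrable_on_Icc_iff_Ioo[symmetric] integrable_const_ivl)
    show "norm (step (\<nu> + \<nu>\<^sub>0) x) \<le> K" for \<nu> x
      unfolding step_def by (rule bound) simp
    show "(\<lambda>\<nu>. step (\<nu> + \<nu>\<^sub>0) x) \<longlonglongrightarrow> \<phi> x" if "x \<in> {0<..<1}" for x
      using LIMSEQ_ignore_initial_segment[OF lim, of x \<nu>\<^sub>0] that by (simp add: step_def)
  qed
  then have "(\<lambda>\<nu>. (\<Sum>j<n (\<nu> + \<nu>\<^sub>0). h (\<nu> + \<nu>\<^sub>0) j) /\<^sub>R real (n (\<nu> + \<nu>\<^sub>0))) \<longlonglongrightarrow> integral {0..1} \<phi>"
    by (simp add: integral_unique[OF step] integral_open_interval_real)
  then show ?thesis by (rule LIMSEQ_offset)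
qed

lemma tendsto_nat_floor_ratio:
  fixes n :: "nat \<Rightarrow> nat"
  assumes n: "(\<lambda>\<nu>. real (n \<nu>) / real \<nu>) \<longlonglongrightarrow> y" and "0 \<le> x"
  shows "(\<lambda>\<nu>. real (nat \<lfloor>real (n \<nu>) * x\<rfloor>) / real \<nu>) \<longlonglongrightarrow> y * x"
proof -
  have "(\<lambda>\<nu>. real (nat \<lfloor>real (n \<nu>) * x\<rfloor>) / real \<nu> - real (n \<nu>) / real \<nu> * x) \<longlonglongrightarrow> 0"
  proof (rule Lim_null_comparison)
    show "\<forall>\<^sub>F \<nu> in sequentially.
        norm (real (nat \<lfloor>real (n \<nu>) * x\<rfloor>) / real \<nu> - real (n \<nu>) / real \<nu> * x) \<le> 1 / real \<nu>"
    proof (intro always_eventually allI)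
      fix \<nu>
      have "\<bar>real (nat \<lfloor>real (n \<nu>) * x\<rfloor>) - real (n \<nu>) * x\<bar> \<le> 1"
      proof -
        have "0 \<le> real (n \<nu>) * x" using \<open>0 \<le> x\<close> by simp
        then show ?thesis by linarith
      qed
      then show "norm (real (nat \<lfloor>real (n \<nu>) * x\<rfloor>) / real \<nu> - real (n \<nu>) / real \<nu> * x) \<le> 1 / real \<nu>"
        by (simp add: divide_right_mono flip: diff_divide_distrib)
    qed
    show "(\<lambda>\<nu>. 1 / real \<nu>) \<longlonglongrightarrow> 0" by real_asymp
  qed
  from tendsto_add[OF this tendsto_mult_right[OF n, of x]] show ?thesis by simp
qed

lemma locally_toeplitz_trace_tendsto:
  assumes M: "locally_toeplitz w M \<sigma>" and N: "(\<lambda>\<nu>. real (N \<nu>) / real \<nu>) \<longlonglongrightarrow> 1"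
  shows "(\<lambda>\<nu>. (\<Sum>j\<le>N \<nu>. M \<nu> j j) / of_nat \<nu>) \<longlonglongrightarrow> integral {0..1} (\<lambda>x. coeff (\<sigma> x) w)"
proof -
  have N': "(\<lambda>\<nu>. real (Suc (N \<nu>)) / real \<nu>) \<longlonglongrightarrow> 1"
    by (rule tendsto_ratio_of_bounded_diff[OF N, of _ 1]) simp_all
  obtain K where K: "\<forall>\<^sub>F \<nu> in sequentially. \<forall>i j. cmod (M \<nu> i j) \<le> K"
    using locally_toeplitz_bounded[OF M] .
  have "(\<lambda>\<nu>. (\<Sum>j<Suc (N \<nu>). M \<nu> j j) /\<^sub>R real (Suc (N \<nu>))) \<longlonglongrightarrow> integral {0..1} (\<lambda>x. coeff (\<sigma> x) w)"
  proof (rule mean_tendsto_integral)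
    show "\<forall>\<^sub>F \<nu> in sequentially. \<forall>j. cmod (M \<nu> j j) \<le> K" using K by eventually_elim simp
    fix x :: real assume x: "0 < x" "x < 1"
    have "(\<lambda>\<nu>. real (nat \<lfloor>real (Suc (N \<nu>)) * x\<rfloor>) / real \<nu>) \<longlonglongrightarrow> x"
      using tendsto_nat_floor_ratio[OF N', of x] x by simp
    from locally_toeplitz_tendsto[OF M x this, of w]
    show "(\<lambda>\<nu>. M \<nu> (nat \<lfloor>real (Suc (N \<nu>)) * x\<rfloor>) (nat \<lfloor>real (Suc (N \<nu>)) * x\<rfloor>)) \<longlonglongrightarrow> coeff (\<sigma> x) w"
      by (simp only: add_diff_cancel_right')
  qed simp
  from tendsto_scaleR[OF N' this]
  have "(\<lambda>\<nu>. (real (Suc (N \<nu>)) / real \<nu>) *\<^sub>R ((\<Sum>j\<le>N \<nu>. M \<nu> j j) /\<^sub>R real (Suc (N \<nu>)))) \<longlonglongrightarrow>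
      integral {0..1} (\<lambda>x. coeff (\<sigma> x) w)"
    by (simp only: lessThan_Suc_atMost scaleR_one)
  moreover have "(real (Suc (N \<nu>)) / real \<nu>) *\<^sub>R (S /\<^sub>R real (Suc (N \<nu>))) = S / of_nat \<nu>"
      for \<nu> and S :: complex
    by (simp add: scaleR_conv_of_real divide_inverse del: of_nat_Suc)
  ultimately show ?thesis by (simp only:)
qed

section \<open>Asymptotics of the Clebsch-Gordan coefficients\<close>

lemma pochhammer_ratio_tendsto:
  fixes y :: "nat \<Rightarrow> real"
  assumes "(\<lambda>\<nu>. y \<nu> / real \<nu>) \<longlonglongrightarrow> x"
  shows "(\<lambda>\<nu>. pochhammer (y \<nu>) c / real \<nu> ^ c) \<longlonglongrightarrow> x ^ c"
proof -
  have "(\<lambda>\<nu>. (y \<nu> + real i) / real \<nu>) \<longlonglongrightarrow> x" for i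
  proof -
    have "(\<lambda>\<nu>. real i / real \<nu>) \<longlonglongrightarrow> 0" by real_asymp
    from tendsto_add[OF assms this] show ?thesis by (simp add: add_divide_distrib)
  qed
  then have "(\<lambda>\<nu>. \<Prod>i<c. (y \<nu> + real i) / real \<nu>) \<longlonglongrightarrow> (\<Prod>i<c. x)"
    by (intro tendsto_prod)
  then show ?thesis by (simp add: pochhammer_prod prod_dividef atLeast0LessThan)
qed

lemma Cmnk_tendsto: "(\<lambda>\<nu>. Cmnk \<mu> \<nu> k) \<longlonglongrightarrow> sqrt (real (\<mu> choose k))"
proof -
  have minus: "(\<lambda>\<nu>. - real \<nu> / real \<nu>) \<longlonglongrightarrow> -1" by real_asymp
  have plus: "(\<lambda>\<nu>. (real \<mu> + real \<nu> - 2 * real k + 2) / real \<nu>) \<longlonglongrightarrow> 1" by real_asymp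
  have "(\<lambda>\<nu>. sqrt ((pochhammer (- real \<nu>) k / real \<nu> ^ k) /
      (pochhammer (real \<mu> + real \<nu> - 2 * real k + 2) k / real \<nu> ^ k) *
        (pochhammer (- real \<mu>) k / fact k)))
      \<longlonglongrightarrow> sqrt ((-1) ^ k / 1 ^ k * (pochhammer (- real \<mu>) k / fact k))"
    by (intro tendsto_intros pochhammer_ratio_tendsto minus plus) simp
  also have "(-1) ^ k / 1 ^ k * (pochhammer (- real \<mu>) k / fact k) = real (\<mu> choose k)"
    using gbinomial_pochhammer[of "real \<mu>" k] by (simp add: binomial_gbinomial)
  finally have "(\<lambda>\<nu>. sqrt ((pochhammer (- real \<nu>) k / real \<nu> ^ k) /
      (pochhammer (real \<mu> + real \<nu> - 2 * real k + 2) k / real \<nu> ^ k) *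
        (pochhammer (- real \<mu>) k / fact k)))
      \<longlonglongrightarrow> sqrt (real (\<mu> choose k))" .
  moreover have "\<forall>\<^sub>F \<nu> in sequentially. sqrt ((pochhammer (- real \<nu>) k / real \<nu> ^ k) /
      (pochhammer (real \<mu> + real \<nu> - 2 * real k + 2) k / real \<nu> ^ k) *
        (pochhammer (- real \<mu>) k / fact k)) = Cmnk \<mu> \<nu> k"
    using eventually_gt_at_top[of 0] by eventually_elim (simp add: Cmnk_def mult_ac)
  ultimately show ?thesis by (rule Lim_transform_eventually)
qed

lemma binomial_ratio_eq_pochhammer:
  assumes "t \<le> n" "c \<le> m"
  shows "real (n choose t) / real (n + m choose (t + c)) =
    pochhammer (real t + 1) c * pochhammer (real (n - t) + 1) (m - c) / pochhammer (real n + 1) m"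
proof -
  have fact_add: "fact (p + q) = (fact p * pochhammer (real p + 1) q :: real)" for p q
    by (simp add: pochhammer_fact pochhammer_product' add.commute)
  have "n + m - (t + c) = n - t + (m - c)" using assms by simp
  then have "real (n + m choose (t + c)) = fact (n + m) / (fact (t + c) * fact (n - t + (m - c)))"
    using binomial_fact[of "t + c" "n + m", where 'a = real] assms by (simp only: add_mono)
  moreover have "real (n choose t) = fact n / (fact t * fact (n - t))"
    using assms by (simp add: binomial_fact)
  ultimately show ?thesis
    unfolding fact_add by simp
qed

lemma binomial_ratio_tendsto:
  fixes t n :: "nat \<Rightarrow> nat"
  assumes t: "(\<lambda>\<nu>. real (t \<nu>) / real \<nu>) \<longlonglongrightarrow> x" and n: "(\<lambda>\<nu>. real (n \<nu>) / real \<nu>) \<longlonglongrightarrow> 1"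
    and x: "x < 1" and c: "c \<le> m"
  shows "(\<lambda>\<nu>. real (n \<nu> choose t \<nu>) / real (n \<nu> + m choose (t \<nu> + c))) \<longlonglongrightarrow> x ^ c * (1 - x) ^ (m - c)"
proof -
  define scaled where "scaled = (\<lambda>y c \<nu>. pochhammer (y \<nu> + 1) c / real \<nu> ^ c)"
  have scaled: "scaled y c \<longlonglongrightarrow> z ^ c" if "(\<lambda>\<nu>. y \<nu> / real \<nu>) \<longlonglongrightarrow> z" for y z c
  proof -
    have "(\<lambda>\<nu>. 1 / real \<nu>) \<longlonglongrightarrow> 0" by real_asymp
    from tendsto_add[OF that this] show ?thesis
      unfolding scaled_def by (intro pochhammer_ratio_tendsto) (simp add: add_divide_distrib)
  qed
  have le: "\<forall>\<^sub>F \<nu> in sequentially. t \<nu> \<le> n \<nu>"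
    using eventually_add_le_of_tendsto_ratio[OF t n x, of 0] by simp
  have diff: "(\<lambda>\<nu>. real (n \<nu> - t \<nu>) / real \<nu>) \<longlonglongrightarrow> 1 - x"
    by (rule Lim_transform_eventually[OF tendsto_diff[OF n t]], use le in eventually_elim)
      (simp add: diff_divide_distrib)
  have "(\<lambda>\<nu>. scaled (\<lambda>\<nu>. real (t \<nu>)) c \<nu> *
      scaled (\<lambda>\<nu>. real (n \<nu> - t \<nu>)) (m - c) \<nu> / scaled (\<lambda>\<nu>. real (n \<nu>)) m \<nu>)
      \<longlonglongrightarrow> x ^ c * (1 - x) ^ (m - c) / 1 ^ m"
    by (intro tendsto_intros scaled t n diff) simp
  moreover have "\<forall>\<^sub>F \<nu> in sequentially. scaled (\<lambda>\<nu>. real (t \<nu>)) c \<nu> *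
      scaled (\<lambda>\<nu>. real (n \<nu> - t \<nu>)) (m - c) \<nu> /
      scaled (\<lambda>\<nu>. real (n \<nu>)) m \<nu> = real (n \<nu> choose t \<nu>) / real (n \<nu> + m choose (t \<nu> + c))"
    using le eventually_gt_at_top[of 0]
  proof eventually_elim
    case (elim \<nu>)
    have "real \<nu> ^ c * real \<nu> ^ (m - c) = real \<nu> ^ m" using c by (simp flip: power_add)
    then show ?case
      using elim by (simp add: scaled_def binomial_ratio_eq_pochhammer[OF elim(1) c])
  qed
  ultimately show ?thesis by (simp add: Lim_transform_eventually)
qed

lemma binomial_le_binomial_add:
  assumes "c \<le> m"
  shows "(n choose t) \<le> (n + m choose (t + c))"
proof (cases "t \<le> n")
  case True
  have "(n choose t) = (n choose (n - t))" using True by (rule binomial_symmetric)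
  also have "\<dots> \<le> (n + c choose (n - t))" by (rule binomial_right_mono) simp
  also have "\<dots> = (n + c choose (t + c))" using True binomial_symmetric[of "t + c" "n + c"] by simp
  also have "\<dots> \<le> (n + m choose (t + c))" using assms by (intro binomial_right_mono) simp
  finally show ?thesis .
qed (simp add: binomial_eq_0)

definition clebsch_gordan_ratio :: "nat \<Rightarrow> nat \<Rightarrow> nat \<Rightarrow> nat \<Rightarrow> nat \<Rightarrow> nat \<Rightarrow> real" where
  "clebsch_gordan_ratio \<mu> \<nu> k l b i = (if k - l \<le> b
     then sqrt (real (\<nu> - k choose (b - (k - l))) / real (\<nu> choose b)) *
       sqrt (real (\<nu> - k choose (b - (k - l))) / real (\<mu> + \<nu> - 2 * k choose i))
     else 0)"

lemma clebsch_gordan_eq_sum_ratio: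
  assumes "a + b = i + k"
  shows "clebsch_gordan \<mu> \<nu> k a b i = Cmnk \<mu> \<nu> k / sqrt (real (\<mu> choose a)) *
    (\<Sum>l\<le>k. krawtchouk_term (\<mu> - k) k a l * clebsch_gordan_ratio \<mu> \<nu> k l b i)"
proof -
  have "clebsch_gordan_ratio \<mu> \<nu> k l b i =
      (if k - l \<le> b then real (\<nu> - k choose (b - (k - l))) else 0) /
        (sqrt (real (\<nu> choose b)) * sqrt (real (\<mu> + \<nu> - 2 * k choose i)))" for l
    by (simp add: clebsch_gordan_ratio_def real_sqrt_divide)
  then show ?thesis
    using assms
    by (simp add: clebsch_gordan_def Jk_coeff_def sum_divide_distrib sum_distrib_left mult_ac)
qed

lemma krawtchouk_term_neq_0D:
  assumes "krawtchouk_term m k a l \<noteq> 0"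
  shows "l \<le> a" "a - l \<le> m"
  using assms by (auto simp: krawtchouk_term_def split: if_splits intro: ccontr)

lemma clebsch_gordan_ratio_le_1:
  assumes "k \<le> \<mu>" "k \<le> \<nu>" "l \<le> k" "l \<le> a" "a - l \<le> \<mu> - k" "a + b = i + k"
  shows "\<bar>clebsch_gordan_ratio \<mu> \<nu> k l b i\<bar> \<le> 1"
proof (cases "k - l \<le> b")
  case True
  define t where "t = b - (k - l)"
  have indices: "\<nu> - k + k = \<nu>" "t + (k - l) = b" "\<nu> - k + (\<mu> - k) = \<mu> + \<nu> - 2 * k" "t + (a - l) = i"
    using assms True by (auto simp: t_def)
  have "(\<nu> - k choose t) \<le> (\<nu> choose b)"
    using binomial_le_binomial_add[of "k - l" k "\<nu> - k" t] unfolding indices by simp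
  moreover have "(\<nu> - k choose t) \<le> (\<mu> + \<nu> - 2 * k choose i)"
    using binomial_le_binomial_add[OF assms(5), of "\<nu> - k" t] unfolding indices by simp
  moreover have sqrt_le: "sqrt (real p / real q) \<le> 1" if "p \<le> q" for p q :: nat
    using that by (cases "q = 0") (simp_all add: divide_le_eq_1)
  ultimately show ?thesis
    using True mult_mono[OF sqrt_le sqrt_le]
    by (simp add: clebsch_gordan_ratio_def abs_mult flip: t_def)
qed (simp add: clebsch_gordan_ratio_def)

lemma abs_clebsch_gordan_le:
  assumes "k \<le> \<mu>" "k \<le> \<nu>" "a \<le> \<mu>"
  shows "\<bar>clebsch_gordan \<mu> \<nu> k a b i\<bar> \<le> \<bar>Cmnk \<mu> \<nu> k\<bar> * (\<Sum>l\<le>k. \<bar>krawtchouk_term (\<mu> - k) k a l\<bar>)"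
proof (cases "a + b = i + k")
  case True
  have "\<bar>\<Sum>l\<le>k. krawtchouk_term (\<mu> - k) k a l * clebsch_gordan_ratio \<mu> \<nu> k l b i\<bar> \<le>
      (\<Sum>l\<le>k. \<bar>krawtchouk_term (\<mu> - k) k a l\<bar>)"
  proof (intro order_trans[OF sum_abs] sum_mono)
    fix l assume "l \<in> {..k}"
    then have "\<bar>clebsch_gordan_ratio \<mu> \<nu> k l b i\<bar> \<le> 1" if "krawtchouk_term (\<mu> - k) k a l \<noteq> 0"
      using krawtchouk_term_neq_0D[OF that]
      by (intro clebsch_gordan_ratio_le_1[OF assms(1,2) _ _ _ True]) auto
    then show "\<bar>krawtchouk_term (\<mu> - k) k a l * clebsch_gordan_ratio \<mu> \<nu> k l b i\<bar> \<le>
        \<bar>krawtchouk_term (\<mu> - k) k a l\<bar>"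
      by (cases "krawtchouk_term (\<mu> - k) k a l = 0") (auto simp: abs_mult intro: mult_left_le)
  qed
  moreover have "\<bar>Cmnk \<mu> \<nu> k / sqrt (real (\<mu> choose a))\<bar> \<le> \<bar>Cmnk \<mu> \<nu> k\<bar>"
  proof -
    have "1 \<le> sqrt (real (\<mu> choose a))" using assms(3) by (simp add: Suc_leI zero_less_binomial)
    then show ?thesis by (simp add: divide_le_eq mult_le_cancel_left1)
  qed
  ultimately show ?thesis
    unfolding clebsch_gordan_eq_sum_ratio[OF True] abs_mult by (intro mult_mono) auto
qed (simp add: clebsch_gordan_def sum_nonneg)

lemma clebsch_gordan_bounded:
  assumes k: "k \<le> \<mu>"
  obtains K where "0 \<le> K" "\<And>\<nu> a b i. k \<le> \<nu> \<Longrightarrow> a \<le> \<mu> \<Longrightarrow> \<bar>clebsch_gordan \<mu> \<nu> k a b i\<bar> \<le> K"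
proof -
  have "Bseq (\<lambda>\<nu>. Cmnk \<mu> \<nu> k)"
    using Cmnk_tendsto by (intro convergent_imp_Bseq convergentI)
  then obtain C where C: "0 < C" "\<And>\<nu>. \<bar>Cmnk \<mu> \<nu> k\<bar> \<le> C" by (auto simp: Bseq_def)
  define S where "S = (\<lambda>a. \<Sum>l\<le>k. \<bar>krawtchouk_term (\<mu> - k) k a l\<bar>)"
  have S_nonneg: "0 \<le> S a" for a by (simp add: S_def sum_nonneg)
  have "\<bar>clebsch_gordan \<mu> \<nu> k a b i\<bar> \<le> C * (\<Sum>a\<le>\<mu>. S a)" if "k \<le> \<nu>" "a \<le> \<mu>" for \<nu> a b i
  proof -
    have "\<bar>clebsch_gordan \<mu> \<nu> k a b i\<bar> \<le> \<bar>Cmnk \<mu> \<nu> k\<bar> * S a"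
      unfolding S_def by (rule abs_clebsch_gordan_le[OF k that])
    also have "\<dots> \<le> C * (\<Sum>a\<le>\<mu>. S a)"
      using C S_nonneg that by (intro mult_mono member_le_sum) auto
    finally show ?thesis .
  qed
  then show thesis
    using C(1) S_nonneg by (intro that[of "C * (\<Sum>a\<le>\<mu>. S a)"]) (simp_all add: sum_nonneg)
qed

definition clebsch_gordan_limit :: "nat \<Rightarrow> nat \<Rightarrow> nat \<Rightarrow> real \<Rightarrow> real" where
  "clebsch_gordan_limit \<mu> k a x = sqrt (real (\<mu> choose k)) / sqrt (real (\<mu> choose a)) *
    (\<Sum>l\<le>k. krawtchouk_term (\<mu> - k) k a l *
      (sqrt x ^ (k - l + (a - l)) * sqrt (1 - x) ^ (\<mu> - (k - l + (a - l)))))"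

lemma clebsch_gordan_ratio_tendsto:
  fixes b i :: "nat \<Rightarrow> nat"
  assumes k: "k \<le> \<mu>" and l: "l \<le> k" "l \<le> a" "a - l \<le> \<mu> - k"
    and b: "(\<lambda>\<nu>. real (b \<nu>) / real \<nu>) \<longlonglongrightarrow> x" and x: "0 < x" "x < 1"
    and i: "\<forall>\<^sub>F \<nu> in sequentially. a + b \<nu> = i \<nu> + k"
  shows "(\<lambda>\<nu>. clebsch_gordan_ratio \<mu> \<nu> k l (b \<nu>) (i \<nu>)) \<longlonglongrightarrow>
    sqrt x ^ (k - l + (a - l)) * sqrt (1 - x) ^ (\<mu> - (k - l + (a - l)))"
proof -
  define t where "t = (\<lambda>\<nu>. b \<nu> - (k - l))"
  have t: "(\<lambda>\<nu>. real (t \<nu>) / real \<nu>) \<longlonglongrightarrow> x"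
    by (rule tendsto_ratio_of_bounded_diff[OF b, of _ k]) (auto simp: t_def)
  have "(\<lambda>\<nu>. real \<nu> / real \<nu>) \<longlonglongrightarrow> 1" by real_asymp
  then have n: "(\<lambda>\<nu>. real (\<nu> - k) / real \<nu>) \<longlonglongrightarrow> 1"
    by (rule tendsto_ratio_of_bounded_diff[of _ _ _ k]) auto
  define r where "r = (\<lambda>m c \<nu>. sqrt (real (\<nu> - k choose t \<nu>) / real (\<nu> - k + m choose (t \<nu> + c))))"
  have r: "r m c \<longlonglongrightarrow> sqrt x ^ c * sqrt (1 - x) ^ (m - c)" if "c \<le> m" for m c
    using tendsto_real_sqrt[OF binomial_ratio_tendsto[OF t n x(2) that]]
    by (simp add: r_def real_sqrt_mult real_sqrt_power)
  have "(\<lambda>\<nu>. r k (k - l) \<nu> * r (\<mu> - k) (a - l) \<nu>) \<longlonglongrightarrow>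
      (sqrt x ^ (k - l) * sqrt (1 - x) ^ (k - (k - l))) *
        (sqrt x ^ (a - l) * sqrt (1 - x) ^ (\<mu> - k - (a - l)))"
    using l by (intro tendsto_mult r) auto
  moreover have "\<mu> - (k - l + (a - l)) = k - (k - l) + (\<mu> - k - (a - l))"
    using k l by linarith
  ultimately have "(\<lambda>\<nu>. r k (k - l) \<nu> * r (\<mu> - k) (a - l) \<nu>) \<longlonglongrightarrow>
      sqrt x ^ (k - l + (a - l)) * sqrt (1 - x) ^ (\<mu> - (k - l + (a - l)))"
    by (simp only: power_add mult_ac)
  moreover have "\<forall>\<^sub>F \<nu> in sequentially.
      r k (k - l) \<nu> * r (\<mu> - k) (a - l) \<nu> = clebsch_gordan_ratio \<mu> \<nu> k l (b \<nu>) (i \<nu>)"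
    using i eventually_ge_at_top[of k] eventually_le_of_tendsto_ratio[OF b x(1), of k]
  proof eventually_elim
    case (elim \<nu>)
    then have "\<nu> - k + k = \<nu>" "t \<nu> + (k - l) = b \<nu>" "\<nu> - k + (\<mu> - k) = \<mu> + \<nu> - 2 * k"
      "t \<nu> + (a - l) = i \<nu>" "k - l \<le> b \<nu>"
      using k l by (auto simp: t_def)
    then show ?case by (simp only: r_def clebsch_gordan_ratio_def if_True) (simp add: t_def)
  qed
  ultimately show ?thesis by (rule Lim_transform_eventually)
qed

lemma clebsch_gordan_tendsto:
  fixes b i :: "nat \<Rightarrow> nat"
  assumes k: "k \<le> \<mu>" and a: "a \<le> \<mu>"
    and b: "(\<lambda>\<nu>. real (b \<nu>) / real \<nu>) \<longlonglongrightarrow> x" and x: "0 < x" "x < 1"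
    and i: "\<forall>\<^sub>F \<nu> in sequentially. a + b \<nu> = i \<nu> + k"
  shows "(\<lambda>\<nu>. clebsch_gordan \<mu> \<nu> k a (b \<nu>) (i \<nu>)) \<longlonglongrightarrow> clebsch_gordan_limit \<mu> k a x"
proof -
  have "(\<lambda>\<nu>. krawtchouk_term (\<mu> - k) k a l * clebsch_gordan_ratio \<mu> \<nu> k l (b \<nu>) (i \<nu>)) \<longlonglongrightarrow>
      krawtchouk_term (\<mu> - k) k a l *
        (sqrt x ^ (k - l + (a - l)) * sqrt (1 - x) ^ (\<mu> - (k - l + (a - l))))"
    if "l \<le> k" for l
  proof (cases "krawtchouk_term (\<mu> - k) k a l = 0")
    case False
    from clebsch_gordan_ratio_tendsto[OF k that krawtchouk_term_neq_0D[OF this] b x i]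
    show ?thesis by (rule tendsto_mult_left)
  qed simp
  then have "(\<lambda>\<nu>. Cmnk \<mu> \<nu> k / sqrt (real (\<mu> choose a)) *
      (\<Sum>l\<le>k. krawtchouk_term (\<mu> - k) k a l * clebsch_gordan_ratio \<mu> \<nu> k l (b \<nu>) (i \<nu>))) \<longlonglongrightarrow>
        clebsch_gordan_limit \<mu> k a x"
    unfolding clebsch_gordan_limit_def using a
    by (intro tendsto_mult[OF tendsto_divide[OF Cmnk_tendsto tendsto_const]] tendsto_sum) auto
  moreover have "\<forall>\<^sub>F \<nu> in sequentially. Cmnk \<mu> \<nu> k / sqrt (real (\<mu> choose a)) *
      (\<Sum>l\<le>k. krawtchouk_term (\<mu> - k) k a l * clebsch_gordan_ratio \<mu> \<nu> k l (b \<nu>) (i \<nu>)) =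
        clebsch_gordan \<mu> \<nu> k a (b \<nu>) (i \<nu>)"
    using i by eventually_elim (simp add: clebsch_gordan_eq_sum_ratio)
  ultimately show ?thesis by (rule Lim_transform_eventually)
qed

lemma sum_clebsch_gordan_mult:
  "(\<Sum>b\<le>\<nu>. clebsch_gordan \<mu> \<nu> k a b i * clebsch_gordan \<mu> \<nu> k a' b j) =
    clebsch_gordan \<mu> \<nu> k a (j + k - a') i * clebsch_gordan \<mu> \<nu> k a' (j + k - a') j"
proof -
  have "clebsch_gordan \<mu> \<nu> k a b i * clebsch_gordan \<mu> \<nu> k a' b j = 0" if "b \<noteq> j + k - a'" for b
    using that by (auto simp: clebsch_gordan_def)
  then have "(\<Sum>b\<le>\<nu>. clebsch_gordan \<mu> \<nu> k a b i * clebsch_gordan \<mu> \<nu> k a' b j) =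
      (\<Sum>b\<in>{..\<nu>} \<inter> {j + k - a'}. clebsch_gordan \<mu> \<nu> k a b i * clebsch_gordan \<mu> \<nu> k a' b j)"
    by (intro sum.mono_neutral_right) auto
  then show ?thesis
    by (cases "j + k - a' \<le> \<nu>") (auto simp: clebsch_gordan_def binomial_eq_0)
qed

definition transfer_symbol :: "nat \<Rightarrow> nat \<Rightarrow> (nat \<Rightarrow> nat \<Rightarrow> complex) \<Rightarrow> real \<Rightarrow> complex poly" where
  "transfer_symbol \<mu> k M x = (\<Sum>a\<le>\<mu>. \<Sum>a'\<le>\<mu>.
     monom (M a a' * of_real (clebsch_gordan_limit \<mu> k a x * clebsch_gordan_limit \<mu> k a' x))
       (\<mu> + a - a'))"

lemma transfer_matrix_bounded:
  assumes "k \<le> \<mu>"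
  obtains K where "\<And>\<nu> i j. k \<le> \<nu> \<Longrightarrow> cmod (transfer_matrix \<mu> \<nu> k M i j) \<le> K"
proof -
  obtain G where G: "0 \<le> G" "\<And>\<nu> a b i. k \<le> \<nu> \<Longrightarrow> a \<le> \<mu> \<Longrightarrow> \<bar>clebsch_gordan \<mu> \<nu> k a b i\<bar> \<le> G"
    using clebsch_gordan_bounded[OF assms] by blast
  have "cmod (transfer_matrix \<mu> \<nu> k M i j) \<le> (\<Sum>a\<le>\<mu>. \<Sum>a'\<le>\<mu>. cmod (M a a') * (G * G))"
    if "k \<le> \<nu>" for \<nu> i j
    unfolding transfer_matrix_def of_real_sum[symmetric] sum_clebsch_gordan_mult
  proof (intro order_trans[OF norm_sum] sum_mono)
    fix a a' assume "a \<in> {..\<mu>}" "a' \<in> {..\<mu>}"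
    then show "cmod (M a a' *
          of_real (clebsch_gordan \<mu> \<nu> k a (j + k - a') i * clebsch_gordan \<mu> \<nu> k a' (j + k - a') j))
        \<le> cmod (M a a') * (G * G)"
      unfolding norm_mult norm_of_real abs_mult using G that
      by (intro mult_left_mono mult_mono) auto
  qed
  then show thesis by (rule that)
qed

lemma banded_transfer_matrix: "banded \<mu> (transfer_matrix \<mu> \<nu> k M)"
  unfolding banded_def
proof (intro allI impI)
  fix i j assume "transfer_matrix \<mu> \<nu> k M i j \<noteq> 0"
  then obtain a a' where "a \<le> \<mu>" "a' \<le> \<mu>"
      "clebsch_gordan \<mu> \<nu> k a (j + k - a') i * clebsch_gordan \<mu> \<nu> k a' (j + k - a') j \<noteq> 0"
    unfolding transfer_matrix_def of_real_sum[symmetric] sum_clebsch_gordan_mult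
    by (elim sum.not_neutral_contains_not_neutral) auto
  moreover from this(3) have "a + (j + k - a') = i + k" "a' + (j + k - a') = j + k"
    by (auto simp: clebsch_gordan_def split: if_splits)
  ultimately show "i \<le> j + \<mu> \<and> j \<le> i + \<mu>" by linarith
qed

lemma clebsch_gordan_mult_tendsto:
  fixes j :: "nat \<Rightarrow> nat"
  assumes k: "k \<le> \<mu>" and aa': "a \<le> \<mu>" "a' \<le> \<mu>"
    and x: "0 < x" "x < 1" and j: "(\<lambda>\<nu>. real (j \<nu>) / real \<nu>) \<longlonglongrightarrow> x"
  shows "(\<lambda>\<nu>. clebsch_gordan \<mu> \<nu> k a (j \<nu> + k - a') (j \<nu> + m - \<mu>) *
      clebsch_gordan \<mu> \<nu> k a' (j \<nu> + k - a') (j \<nu>)) \<longlonglongrightarrow>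
    (if \<mu> + a - a' = m then clebsch_gordan_limit \<mu> k a x * clebsch_gordan_limit \<mu> k a' x else 0)"
proof -
  have large: "\<forall>\<^sub>F \<nu> in sequentially. \<mu> \<le> j \<nu>" by (rule eventually_le_of_tendsto_ratio[OF j x(1)])
  show ?thesis
  proof (cases "\<mu> + a - a' = m")
    case True
    have b: "(\<lambda>\<nu>. real (j \<nu> + k - a') / real \<nu>) \<longlonglongrightarrow> x"
      by (rule tendsto_ratio_of_bounded_diff[OF j, of _ "k + \<mu>"]) (use aa' in auto)
    have row: "\<forall>\<^sub>F \<nu> in sequentially. a + (j \<nu> + k - a') = j \<nu> + m - \<mu> + k"
      using large by eventually_elim (use True aa' in linarith)
    have col: "\<forall>\<^sub>F \<nu> in sequentially. a' + (j \<nu> + k - a') = j \<nu> + k"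
      using large by eventually_elim (use aa' in linarith)
    show ?thesis
      using tendsto_mult[OF clebsch_gordan_tendsto[OF k aa'(1) b x row]
        clebsch_gordan_tendsto[OF k aa'(2) b x col]] True
      by simp
  next
    case False
    have "\<forall>\<^sub>F \<nu> in sequentially.
        0 = clebsch_gordan \<mu> \<nu> k a (j \<nu> + k - a') (j \<nu> + m - \<mu>) *
          clebsch_gordan \<mu> \<nu> k a' (j \<nu> + k - a') (j \<nu>)"
      using large
    proof eventually_elim
      case (elim \<nu>)
      then have "a + (j \<nu> + k - a') \<noteq> j \<nu> + m - \<mu> + k" using False aa' by linarith
      then show ?case by (simp add: clebsch_gordan_def)
    qed
    then show ?thesis using False by (simp add: Lim_transform_eventually[OF tendsto_const])
  qed
qed

lemma locally_toeplitz_transfer_matrix: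
  assumes k: "k \<le> \<mu>"
  shows "locally_toeplitz \<mu> (\<lambda>\<nu>. transfer_matrix \<mu> \<nu> k M) (transfer_symbol \<mu> k M)"
proof -
  obtain K where K: "\<And>\<nu> i j. k \<le> \<nu> \<Longrightarrow> cmod (transfer_matrix \<mu> \<nu> k M i j) \<le> K"
    using transfer_matrix_bounded[OF k] by blast
  show ?thesis
  proof (rule locally_toeplitzI[OF banded_transfer_matrix])
    show "\<forall>\<^sub>F \<nu> in sequentially. \<forall>i j. cmod (transfer_matrix \<mu> \<nu> k M i j) \<le> K"
      using eventually_ge_at_top[of k] by eventually_elim (simp add: K)
  next
    fix x j m assume x: "0 < x" "x < 1" and j: "(\<lambda>\<nu>. real (j \<nu>) / real \<nu>) \<longlonglongrightarrow> x"
    define g where "g = (\<lambda>a. clebsch_gordan_limit \<mu> k a x)"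
    have "(\<lambda>\<nu>. transfer_matrix \<mu> \<nu> k M (j \<nu> + m - \<mu>) (j \<nu>)) \<longlonglongrightarrow>
        (\<Sum>a\<le>\<mu>. \<Sum>a'\<le>\<mu>. M a a' * of_real (if \<mu> + a - a' = m then g a * g a' else 0))"
      unfolding transfer_matrix_def of_real_sum[symmetric] sum_clebsch_gordan_mult g_def
      by (intro tendsto_sum tendsto_mult tendsto_const tendsto_of_real
          clebsch_gordan_mult_tendsto k x j) auto
    also have "(\<Sum>a\<le>\<mu>. \<Sum>a'\<le>\<mu>. M a a' * of_real (if \<mu> + a - a' = m then g a * g a' else 0)) =
        coeff (transfer_symbol \<mu> k M x) m"
      by (auto simp: transfer_symbol_def coeff_sum g_def intro!: sum.cong)
    finally show "(\<lambda>\<nu>. transfer_matrix \<mu> \<nu> k M (j \<nu> + m - \<mu>) (j \<nu>)) \<longlonglongrightarrow>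
        coeff (transfer_symbol \<mu> k M x) m" .
  qed
qed

lemma trace_H_Tmap_funpow_tendsto:
  assumes k: "k \<le> \<mu>" and A: "has_matrix \<mu> A M"
  shows "(\<lambda>\<nu>. trace_H (\<mu> + \<nu> - 2 * k) (Tmap \<mu> \<nu> k A ^^ n) / of_nat \<nu>) \<longlonglongrightarrow>
    integral {0..1} (\<lambda>x. coeff (transfer_symbol \<mu> k M x ^ n) (n * \<mu>))"
proof -
  define N where "N = (\<lambda>\<nu>. \<mu> + \<nu> - 2 * k)"
  have "(\<lambda>\<nu>. real \<nu> / real \<nu>) \<longlonglongrightarrow> 1" by real_asymp
  then have N: "(\<lambda>\<nu>. real (N \<nu>) / real \<nu>) \<longlonglongrightarrow> 1"
    by (rule tendsto_ratio_of_bounded_diff[of _ _ _ "\<mu> + 2 * k"]) (auto simp: N_def)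
  note locally_toeplitz_power[OF locally_toeplitz_transfer_matrix[OF k] N]
  from locally_toeplitz_trace_tendsto[OF this N]
  have "(\<lambda>\<nu>. (\<Sum>j\<le>N \<nu>. mat_power (N \<nu>) (transfer_matrix \<mu> \<nu> k M) n j j) / of_nat \<nu>) \<longlonglongrightarrow>
      integral {0..1} (\<lambda>x. coeff (transfer_symbol \<mu> k M x ^ n) (n * \<mu>))" .
  moreover have "\<forall>\<^sub>F \<nu> in sequentially.
      (\<Sum>j\<le>N \<nu>. mat_power (N \<nu>) (transfer_matrix \<mu> \<nu> k M) n j j) / of_nat \<nu> =
      trace_H (\<mu> + \<nu> - 2 * k) (Tmap \<mu> \<nu> k A ^^ n) / of_nat \<nu>"
    using eventually_ge_at_top[of k]
    by eventually_elim
      (simp add: N_def trace_H_has_matrix[OF has_matrix_funpow[OF has_matrix_Tmap[OF k _ A]]])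
  ultimately show ?thesis by (rule Lim_transform_eventually)
qed

section \<open>The limit symbol\<close>

lemma sum_alternating_binomial_mult_power:
  fixes x :: "'a::comm_ring_1"
  assumes "k \<le> \<mu>"
  shows "(\<Sum>l\<le>k. (-1) ^ (k - l) * of_nat (k choose l) * x ^ (\<mu> - l)) = x ^ (\<mu> - k) * (1 - x) ^ k"
proof -
  have "x ^ (\<mu> - k) * (1 - x) ^ k = (\<Sum>l\<le>k. x ^ (\<mu> - k) * (of_nat (k choose l) * (- x) ^ (k - l)))"
    using binomial_ring[of 1 "- x" k] by (simp add: sum_distrib_left)
  also have "\<dots> = (\<Sum>l\<le>k. (-1) ^ (k - l) * of_nat (k choose l) * x ^ (\<mu> - l))"
  proof (rule sum.cong[OF refl])
    fix l assume "l \<in> {..k}"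
    then have "x ^ (\<mu> - l) = x ^ (\<mu> - k) * x ^ (k - l)" using assms by (simp flip: power_add)
    then show "x ^ (\<mu> - k) * (of_nat (k choose l) * (- x) ^ (k - l)) =
        (-1) ^ (k - l) * of_nat (k choose l) * x ^ (\<mu> - l)"
      by (simp add: power_minus[of x] mult_ac)
  qed
  finally show ?thesis by simp
qed

definition berezin_kernel :: "complex \<Rightarrow> complex \<Rightarrow> real" where
  "berezin_kernel z s = (cmod (1 + z * cnj s))^2 / ((1 + (cmod z)^2) * (1 + (cmod s)^2))"

lemma berezin_kernel_measurable [measurable]: "berezin_kernel z \<in> borel_measurable borel"
  unfolding berezin_kernel_def by measurable

lemma one_minus_berezin_kernel:
  "1 - berezin_kernel z s = (cmod (s - z))^2 / ((1 + (cmod z)^2) * (1 + (cmod s)^2))"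
proof -
  have "(1 + (cmod z)^2) * (1 + (cmod s)^2) - (cmod (1 + z * cnj s))^2 = (cmod (s - z))^2"
    unfolding cmod_power2 by (simp add: power2_eq_square algebra_simps)
  then show ?thesis by (simp add: berezin_kernel_def diff_divide_distrib[symmetric] divide_simps)
qed

lemma berezin_kernel_nonneg: "0 \<le> berezin_kernel z s"
  by (simp add: berezin_kernel_def)

lemma berezin_kernel_le_1: "berezin_kernel z s \<le> 1"
proof -
  have "0 \<le> 1 - berezin_kernel z s" unfolding one_minus_berezin_kernel by simp
  then show ?thesis by simp
qed

lemma Berezin_eq_integral_kernel:
  "Berezin \<tau> f z = (LINT s|iota 0. f s * of_real (berezin_kernel z s ^ \<tau>))"
proof -
  have "cmod (1 + z * cnj s) ^ (2 * \<tau>) / ((1 + (cmod z)^2) ^ \<tau> * (1 + (cmod s)^2) ^ \<tau>) =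
      berezin_kernel z s ^ \<tau>" for s
    by (simp only: berezin_kernel_def power_mult power_divide power_mult_distrib)
  then show ?thesis unfolding Berezin_def by (simp only: mult.commute[of _ "f _"])
qed

lemma E_eq_integral_kernel:
  assumes k: "k \<le> \<mu>" and f: "f \<in> borel_measurable borel" "bounded (range f)"
  shows "E \<mu> k f z = of_nat (\<mu> choose k) *
    (LINT s|iota 0. f s * of_real (berezin_kernel z s ^ (\<mu> - k) * (1 - berezin_kernel z s) ^ k))"
proof -
  have "integrable (iota 0) (\<lambda>s. complex_of_real (berezin_kernel z s ^ m))" for m
    by (intro integrable_iota_bound[where K = 1])
      (auto simp: norm_power berezin_kernel_nonneg berezin_kernel_le_1 power_le_one)
  then have integrable: "integrable (iota 0) (\<lambda>s. f s * of_real (berezin_kernel z s ^ m))" for m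
    using f by (intro integrable_bounded_mult) auto
  have "E \<mu> k f z = of_nat (\<mu> choose k) *
      (LINT s|iota 0. (\<Sum>l\<le>k. (-1) ^ (k - l) * of_nat (k choose l) *
        (f s * of_real (berezin_kernel z s ^ (\<mu> - l)))))"
    unfolding E_def Berezin_eq_integral_kernel
    by (subst Bochner_Integration.integral_sum)
      (simp_all only: integral_mult_right_zero integrable_mult_right integrable)
  also have "(\<lambda>s. \<Sum>l\<le>k. (-1) ^ (k - l) * of_nat (k choose l) *
      (f s * of_real (berezin_kernel z s ^ (\<mu> - l)))) =
      (\<lambda>s. f s * of_real (\<Sum>l\<le>k. (-1) ^ (k - l) * of_nat (k choose l) * berezin_kernel z s ^ (\<mu> - l)))"
    by (simp add: sum_distrib_left mult_ac)
  finally show ?thesis unfolding sum_alternating_binomial_mult_power[OF k] .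
qed

definition coherent_vector :: "nat \<Rightarrow> nat \<Rightarrow> complex \<Rightarrow> complex \<Rightarrow> complex" where
  "coherent_vector \<mu> k z s = of_real (sqrt (real (\<mu> choose k)) / sqrt (1 + (cmod z)^2) ^ \<mu>) *
    ((1 + cnj z * s) ^ (\<mu> - k) * (s - z) ^ k)"

lemma coherent_vector_mult_cnj:
  assumes "k \<le> \<mu>"
  shows "coherent_vector \<mu> k z s * cnj (coherent_vector \<mu> k z s) =
    of_real (real (\<mu> choose k) * (berezin_kernel z s ^ (\<mu> - k) * (1 - berezin_kernel z s) ^ k) *
      (1 + (cmod s)^2) ^ \<mu>)"
proof -
  define Z S where "Z = 1 + (cmod z)^2" and "S = 1 + (cmod s)^2"
  have pos: "Z > 0" "S > 0" by (simp_all add: Z_def S_def)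
  have "cmod (1 + cnj z * s) = cmod (1 + z * cnj s)"
    by (metis complex_cnj_add complex_cnj_cnj complex_cnj_mult complex_cnj_one complex_mod_cnj)
  moreover have "sqrt Z ^ (2 * \<mu>) = Z ^ \<mu>" using pos by (simp add: power_mult)
  ultimately have "(cmod (coherent_vector \<mu> k z s))^2 =
      real (\<mu> choose k) / Z ^ \<mu> * ((cmod (1 + z * cnj s))^2) ^ (\<mu> - k) * ((cmod (s - z))^2) ^ k"
    using pos
    by (simp add: coherent_vector_def norm_mult norm_divide norm_power power_mult_distrib power_divide
        mult.commute[of 2] flip: power_mult Z_def)
  also have "(cmod (1 + z * cnj s))^2 = berezin_kernel z s * (Z * S)"
    using pos by (simp add: berezin_kernel_def Z_def S_def)
  also have "(cmod (s - z))^2 = (1 - berezin_kernel z s) * (Z * S)"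
    using pos by (simp add: one_minus_berezin_kernel Z_def S_def)
  also have "real (\<mu> choose k) / Z ^ \<mu> * (berezin_kernel z s * (Z * S)) ^ (\<mu> - k) *
      ((1 - berezin_kernel z s) * (Z * S)) ^ k =
      real (\<mu> choose k) / Z ^ \<mu> * (berezin_kernel z s ^ (\<mu> - k) * (1 - berezin_kernel z s) ^ k) *
        (Z * S) ^ (\<mu> - k + k)"
    by (simp add: power_mult_distrib power_add)
  also have "\<dots> = real (\<mu> choose k) * (berezin_kernel z s ^ (\<mu> - k) * (1 - berezin_kernel z s) ^ k) *
      S ^ \<mu>"
    using pos assms by (simp add: power_mult_distrib)
  finally show ?thesis by (simp only: S_def flip: complex_norm_square)
qed

lemma E_eq_integral_coherent_vector:
  assumes k: "k \<le> \<mu>" and f: "f \<in> borel_measurable borel" "bounded (range f)"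
  shows "E \<mu> k f z = 1 / (of_nat \<mu> + 1) *
    (LINT s|iota \<mu>. f s * (coherent_vector \<mu> k z s * cnj (coherent_vector \<mu> k z s)))"
proof -
  define q where "q = (\<lambda>s. berezin_kernel z s ^ (\<mu> - k) * (1 - berezin_kernel z s) ^ k)"
  have [measurable]: "q \<in> borel_measurable borel" unfolding q_def by measurable
  have "iota_weight \<mu> s *\<^sub>R (f s * (coherent_vector \<mu> k z s * cnj (coherent_vector \<mu> k z s))) =
      ((of_nat \<mu> + 1) * of_nat (\<mu> choose k)) * (f s * of_real (q s))" for s
  proof -
    define S where "S = (1 + (cmod s)^2) ^ \<mu>"
    have "S \<noteq> 0" by (simp add: S_def)
    then show ?thesis
      unfolding coherent_vector_mult_cnj[OF k] iota_weight_def S_def[symmetric] scaleR_conv_of_real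
      by (simp add: q_def)
  qed
  moreover have "(\<lambda>s. f s *
      (coherent_vector \<mu> k z s * cnj (coherent_vector \<mu> k z s))) \<in> borel_measurable borel"
    using f(1) unfolding coherent_vector_def by measurable
  ultimately have "(LINT s|iota \<mu>. f s * (coherent_vector \<mu> k z s * cnj (coherent_vector \<mu> k z s))) =
      ((of_nat \<mu> + 1) * of_nat (\<mu> choose k)) * (LINT s|iota 0. f s * of_real (q s))"
    by (simp add: integral_iota_eq)
  moreover have "of_nat \<mu> + 1 \<noteq> (0::complex)" by (metis of_nat_Suc of_nat_neq_0 add.commute)
  ultimately show ?thesis by (simp add: E_eq_integral_kernel[OF assms] q_def)
qed

lemma sgn_power_mult_cnj_power:
  assumes "z \<noteq> 0" "q \<le> p"
  shows "sgn z ^ p * cnj (sgn z) ^ q = sgn z ^ (p - q)"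
proof -
  have "sgn z ^ p * cnj (sgn z) ^ q = sgn z ^ (p - q) * (sgn z * cnj (sgn z)) ^ q"
    using assms(2) by (simp add: power_mult_distrib flip: power_add mult.assoc)
  then show ?thesis by (simp add: sgn_mult_cnj[OF assms(1)])
qed

lemma krawtchouk_term_mult_monomial_polar:
  assumes k: "k \<le> \<mu>" and l: "l \<le> k" and z: "z \<noteq> 0"
  shows "of_real (krawtchouk_term (\<mu> - k) k a l) *
      (z ^ (k - l) * cnj z ^ (a - l) / of_real (sqrt (1 + (cmod z)^2) ^ \<mu>)) =
    of_real (krawtchouk_term (\<mu> - k) k a l * (sqrt (sphere_coord z) ^ (k - l + (a - l)) *
      sqrt (1 - sphere_coord z) ^ (\<mu> - (k - l + (a - l))))) * (sgn z ^ k * cnj (sgn z) ^ a)"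
proof (cases "krawtchouk_term (\<mu> - k) k a l = 0")
  case False
  note la = krawtchouk_term_neq_0D[OF False]
  have "sgn z ^ k * cnj (sgn z) ^ a =
      sgn z ^ (k - l) * cnj (sgn z) ^ (a - l) * (sgn z * cnj (sgn z)) ^ l"
    using l la(1) by (simp add: power_mult_distrib mult_ac flip: power_add)
  moreover have "k - l + (a - l) \<le> \<mu>" using la(2) k by linarith
  ultimately show ?thesis
    by (simp only: monomial_polar of_real_mult mult.assoc sgn_mult_cnj[OF z] power_one mult_1_right)
qed simp

lemma coherent_vector_eq_lincomb_onb:
  assumes k: "k \<le> \<mu>" and z: "z \<noteq> 0"
  shows "coherent_vector \<mu> k z =
    lincomb_onb \<mu> (\<lambda>a. of_real (clebsch_gordan_limit \<mu> k a (sphere_coord z)) *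
      (sgn z ^ k * cnj (sgn z) ^ a))"
proof
  fix s
  define S x where "S = sqrt (1 + (cmod z)^2) ^ \<mu>" and "x = sphere_coord z"
  define K where "K = krawtchouk_term (\<mu> - k) k"
  define P where "P = (\<lambda>a l. sqrt x ^ (k - l + (a - l)) * sqrt (1 - x) ^ (\<mu> - (k - l + (a - l))))"
  have "coherent_vector \<mu> k z s = of_real (sqrt (real (\<mu> choose k))) *
      (\<Sum>a\<le>\<mu>. (\<Sum>l\<le>k. of_real (K a l) * (z ^ (k - l) * cnj z ^ (a - l) / of_real S)) * s ^ a)"
    unfolding coherent_vector_def S_def[symmetric] using k
    by (simp add: power_mult_power_eq_sum_krawtchouk K_def flip: sum_divide_distrib)
  also have "\<dots> = (\<Sum>a\<le>\<mu>. of_real (clebsch_gordan_limit \<mu> k a x) * (sgn z ^ k * cnj (sgn z) ^ a) *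
      onb \<mu> a s)"
    unfolding sum_distrib_left
  proof (rule sum.cong[OF refl])
    fix a assume "a \<in> {..\<mu>}"
    then have "sqrt (real (\<mu> choose a)) > 0" by simp
    then have "of_real (sqrt (real (\<mu> choose k)) * (\<Sum>l\<le>k. K a l * P a l)) =
        of_real (clebsch_gordan_limit \<mu> k a x) * complex_of_real (sqrt (real (\<mu> choose a)))"
      unfolding of_real_mult[symmetric] by (simp add: clebsch_gordan_limit_def K_def P_def)
    moreover have "(\<Sum>l\<le>k. of_real (K a l) * (z ^ (k - l) * cnj z ^ (a - l) / of_real S)) =
        of_real (\<Sum>l\<le>k. K a l * P a l) * (sgn z ^ k * cnj (sgn z) ^ a)"
      unfolding of_real_sum sum_distrib_right S_def K_def P_def x_def
      by (intro sum.cong refl krawtchouk_term_mult_monomial_polar k z) simp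
    ultimately show "of_real (sqrt (real (\<mu> choose k))) *
        ((\<Sum>l\<le>k. of_real (K a l) * (z ^ (k - l) * cnj z ^ (a - l) / of_real S)) * s ^ a) =
        of_real (clebsch_gordan_limit \<mu> k a x) * (sgn z ^ k * cnj (sgn z) ^ a) * onb \<mu> a s"
      by (simp only: onb_def of_real_mult mult_ac)
  qed
  finally show "coherent_vector \<mu> k z s = lincomb_onb \<mu>
      (\<lambda>a. of_real (clebsch_gordan_limit \<mu> k a (sphere_coord z)) * (sgn z ^ k * cnj (sgn z) ^ a)) s"
    by (simp add: lincomb_onb_def x_def)
qed

lemma E_eq_poly_transfer_symbol:
  assumes k: "k \<le> \<mu>" and f: "f \<in> borel_measurable borel" "bounded (range f)" and z: "z \<noteq> 0"
  shows "E \<mu> k f z =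
      poly (transfer_symbol \<mu> k (Rstar_matrix \<mu> f) (sphere_coord z)) (sgn z) * cnj (sgn z) ^ \<mu>"
proof -
  define u where "u = sgn z"
  define g where "g = (\<lambda>a. complex_of_real (clebsch_gordan_limit \<mu> k a (sphere_coord z)))"
  have u: "u * cnj u = 1" using sgn_mult_cnj[OF z] by (simp add: u_def)
  have "E \<mu> k f z = 1 / (of_nat \<mu> + 1) * (LINT s|iota \<mu>. f s *
      ((\<Sum>j\<le>\<mu>. g j * (u ^ k * cnj u ^ j) * onb \<mu> j s) *
        (\<Sum>i\<le>\<mu>. cnj (g i * (u ^ k * cnj u ^ i)) * cnj (onb \<mu> i s))))"
    unfolding E_eq_integral_coherent_vector[OF k f] coherent_vector_eq_lincomb_onb[OF k z]
    by (simp add: lincomb_onb_def g_def u_def)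
  also have "\<dots> = (\<Sum>i\<le>\<mu>. \<Sum>j\<le>\<mu>. Rstar_matrix \<mu> f i j * (g j * (u ^ k * cnj u ^ j)) *
      cnj (g i * (u ^ k * cnj u ^ i)))"
    by (rule integral_mult_sum_onb_sum_cnj_onb[OF f])
  also have "\<dots> = (\<Sum>i\<le>\<mu>. \<Sum>j\<le>\<mu>. Rstar_matrix \<mu> f i j * (g i * g j) * u ^ (\<mu> + i - j) * cnj u ^ \<mu>)"
  proof (intro sum.cong refl)
    fix i j assume "i \<in> {..\<mu>}" "j \<in> {..\<mu>}"
    then have "u ^ (\<mu> + i - j) * cnj u ^ \<mu> = u ^ (\<mu> + i) * cnj u ^ j * cnj u ^ \<mu>"
      unfolding u_def by (subst sgn_power_mult_cnj_power[OF z]) simp_all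
    also have "\<dots> = (u * cnj u) ^ \<mu> * (u ^ i * cnj u ^ j)"
      by (simp add: power_mult_distrib power_add)
    also have "\<dots> = (u * cnj u) ^ k * (u ^ i * cnj u ^ j)" by (simp add: u)
    also have "\<dots> = (u ^ k * cnj u ^ j) * (cnj u ^ k * u ^ i)" by (simp add: power_mult_distrib)
    finally show "Rstar_matrix \<mu> f i j * (g j * (u ^ k * cnj u ^ j)) * cnj (g i * (u ^ k * cnj u ^ i)) =
        Rstar_matrix \<mu> f i j * (g i * g j) * u ^ (\<mu> + i - j) * cnj u ^ \<mu>"
      by (simp add: g_def mult_ac)
  qed
  also have "\<dots> = poly (transfer_symbol \<mu> k (Rstar_matrix \<mu> f) (sphere_coord z)) u * cnj u ^ \<mu>"
    by (simp add: transfer_symbol_def poly_sum poly_monom sum_distrib_right g_def)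
  finally show ?thesis by (simp only: u_def)
qed

lemma integrable_iota_polar:
  fixes \<phi> :: "real \<Rightarrow> complex"
  assumes \<phi>: "continuous_on UNIV \<phi>"
  shows "integrable (iota 0) (\<lambda>z. \<phi> (sphere_coord z) * (sgn z ^ p * cnj (sgn z) ^ q))"
proof -
  have [measurable]: "\<phi> \<in> borel_measurable borel" using \<phi> by (rule borel_measurable_continuous_onI)
  have "bounded (\<phi> ` {0..1})"
    by (intro compact_imp_bounded compact_continuous_image continuous_on_subset[OF \<phi>]) auto
  then obtain B where B: "B > 0" "\<And>x. x \<in> {0..1} \<Longrightarrow> cmod (\<phi> x) \<le> B" by (auto simp: bounded_pos)
  have "cmod (\<phi> (sphere_coord z) * (sgn z ^ p * cnj (sgn z) ^ q)) \<le> B * 1" for z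
  proof -
    have "cmod (sgn z) ^ p * cmod (sgn z) ^ q \<le> 1"
      by (intro mult_le_one power_le_one) (simp_all add: norm_sgn)
    then show ?thesis
      unfolding norm_mult norm_power complex_mod_cnj using B
      by (intro mult_mono) (simp_all add: less_imp_le)
  qed
  then show ?thesis by (intro integrable_iota_bound[where K = B]) auto
qed

lemma poly_eq_sum_coeff:
  fixes p :: "'a::comm_semiring_1 poly"
  assumes "degree p \<le> d"
  shows "poly p u = (\<Sum>m\<le>d. coeff p m * u ^ m)"
  unfolding poly_altdef using assms by (intro sum.mono_neutral_left) (auto simp: coeff_eq_0)

lemma borel_measurable_poly_sphere_coord_sgn:
  fixes p :: "real \<Rightarrow> complex poly"
  assumes "\<And>m. continuous_on UNIV (\<lambda>x. coeff (p x) m)" and "\<And>x. degree (p x) \<le> d"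
  shows "(\<lambda>z. poly (p (sphere_coord z)) (sgn z)) \<in> borel_measurable borel"
proof -
  have [measurable]: "(\<lambda>x. coeff (p x) m) \<in> borel_measurable borel" for m
    using assms(1) by (rule borel_measurable_continuous_onI)
  show ?thesis unfolding poly_eq_sum_coeff[OF assms(2)] by measurable
qed

lemma integral_iota_poly_sgn:
  fixes p :: "real \<Rightarrow> complex poly"
  assumes cont: "\<And>m. continuous_on UNIV (\<lambda>x. coeff (p x) m)" and deg: "\<And>x. degree (p x) \<le> d"
  shows "(LINT z|iota 0. poly (p (sphere_coord z)) (sgn z) * cnj (sgn z) ^ w) =
      integral {0..1} (\<lambda>x. coeff (p x) w)"
proof -
  define D where "D = max d w"
  have "degree (p x) \<le> D" for x using deg[of x] by (simp add: D_def)
  then have "(LINT z|iota 0. poly (p (sphere_coord z)) (sgn z) * cnj (sgn z) ^ w) =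
      (LINT z|iota 0. (\<Sum>m\<le>D. coeff (p (sphere_coord z)) m * (sgn z ^ m * cnj (sgn z) ^ w)))"
    by (simp add: poly_eq_sum_coeff[of _ D] sum_distrib_right mult.assoc)
  also have "\<dots> = (\<Sum>m\<le>D. LINT z|iota 0. coeff (p (sphere_coord z)) m * (sgn z ^ m * cnj (sgn z) ^ w))"
    by (intro Bochner_Integration.integral_sum integrable_iota_polar cont)
  also have "\<dots> = (\<Sum>m\<le>D. if m = w then integral {0..1} (\<lambda>x. coeff (p x) m) else 0)"
    by (intro sum.cong refl integral_iota_polar cont)
  also have "\<dots> = integral {0..1} (\<lambda>x. coeff (p x) w)"
    by (simp add: D_def)
  finally show ?thesis .
qed

lemma continuous_on_coeff_power:
  fixes p :: "'a::topological_space \<Rightarrow>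
      'b::{comm_semiring_1, topological_semigroup_mult, topological_comm_monoid_add} poly"
  assumes "\<And>m. continuous_on S (\<lambda>x. coeff (p x) m)"
  shows "continuous_on S (\<lambda>x. coeff (p x ^ n) m)"
proof (induction n arbitrary: m)
  case 0
  show ?case by simp
next
  case (Suc n)
  then show ?case using assms by (simp add: coeff_mult) (intro continuous_intros)
qed

lemma continuous_on_clebsch_gordan_limit: "continuous_on S (clebsch_gordan_limit \<mu> k a)"
  unfolding clebsch_gordan_limit_def by (intro continuous_intros)

lemma continuous_on_coeff_transfer_symbol: "continuous_on S (\<lambda>x. coeff (transfer_symbol \<mu> k M x) m)"
proof -
  have "continuous_on S (\<lambda>x. coeff (monom (M a a' *
      of_real (clebsch_gordan_limit \<mu> k a x * clebsch_gordan_limit \<mu> k a' x)) i) m)" for a a' i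
    by (cases "i = m") (auto intro!: continuous_intros continuous_on_clebsch_gordan_limit)
  then show ?thesis unfolding transfer_symbol_def coeff_sum by (intro continuous_on_sum)
qed

lemma degree_transfer_symbol_le: "degree (transfer_symbol \<mu> k M x) \<le> 2 * \<mu>"
  unfolding transfer_symbol_def
  by (intro degree_sum_le) (auto intro: order_trans[OF degree_monom_le])

lemma integral_E_power:
  assumes k: "k \<le> \<mu>" and f: "f \<in> borel_measurable borel" "bounded (range f)"
  shows "(LINT z|iota 0. E \<mu> k f z ^ n) =
    integral {0..1} (\<lambda>x. coeff (transfer_symbol \<mu> k (Rstar_matrix \<mu> f) x ^ n) (n * \<mu>))"
proof -
  define p where "p = (\<lambda>x. transfer_symbol \<mu> k (Rstar_matrix \<mu> f) x ^ n)"
  define F where "F = (\<lambda>z. poly (p (sphere_coord z)) (sgn z) * cnj (sgn z) ^ (n * \<mu>))"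
  have cont: "continuous_on UNIV (\<lambda>x. coeff (p x) m)" for m
    unfolding p_def by (intro continuous_on_coeff_power continuous_on_coeff_transfer_symbol)
  have deg: "degree (p x) \<le> 2 * \<mu> * n" for x
    unfolding p_def using order_trans[OF degree_power_le] degree_transfer_symbol_le mult_right_mono
    by blast
  have integral_F: "(LINT z|iota 0. F z) = integral {0..1} (\<lambda>x. coeff (p x) (n * \<mu>))"
    unfolding F_def by (rule integral_iota_poly_sgn[OF cont deg])
  have [measurable]: "F \<in> borel_measurable borel"
    unfolding F_def
    by (intro borel_measurable_times borel_measurable_poly_sphere_coord_sgn[OF cont deg]) measurable
  define value_at_0 where "value_at_0 = E \<mu> k f 0 ^ n"
  have E_power_eq: "E \<mu> k f z ^ n = (if z = 0 then value_at_0 else F z)" for z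
    using E_eq_poly_transfer_symbol[OF k f, of z]
    by (simp add: value_at_0_def F_def p_def power_mult_distrib mult.commute[of n] power_mult)
  have "(LINT z|iota 0. E \<mu> k f z ^ n) = (LINT z|iota 0. F z)"
    unfolding E_power_eq
  proof (rule integral_cong_AE)
    show "AE z in iota 0. (if z = 0 then value_at_0 else F z) = F z"
      using AE_iota_nonzero by eventually_elim simp
  qed measurable
  then show ?thesis by (simp add: integral_F p_def)
qed

theorem mainTheorem9:
  fixes \<mu> k n :: nat and f :: "complex \<Rightarrow> complex"
  assumes "k \<le> \<mu>" and "cont_CP1 f" and "n > 0"
  shows "(\<lambda>\<nu>. trace_H (\<mu> + \<nu> - 2 * k) ((Tmap \<mu> \<nu> k (Rstar \<mu> f)) ^^ n) / of_nat \<nu>)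
           \<longlonglongrightarrow> (LINT z|iota 0. (E \<mu> k f z) ^ n)"
proof -
  have f: "f \<in> borel_measurable borel" "bounded (range f)"
    using assms(2)
    by (auto simp: cont_CP1_def
        intro: borel_measurable_continuous_onI bounded_range_tendsto_at_infinity)
  show ?thesis
    unfolding integral_E_power[OF assms(1) f]
    by (rule trace_H_Tmap_funpow_tendsto[OF assms(1) has_matrix_Rstar[OF f]])
qed

end
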